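(* The following sequences $\{\mathbf A_n:n\ge1\}$ of symmetric $n\times n$ matrices satisfy $\|\mathbf A_n\|=O(1)$ and $\mathrm{Tr}(\mathbf A_n^2)=o(n)$. (i) (Complete graph) For $\beta>0$, $\mathbf A_n=\frac\beta n(\mathbf 1\mathbf 1^\top-\mathbf I_n)$, the scaled adjacency matrix of the complete graph on $n$ vertices. (ii) (Regular graphs) For $\beta>0$, $\mathbf A_n(i,j)=\frac\beta{d_n}\mathbf 1(i\sim j)$, where $\mathscr G_n$ is a sequence of $d_n$-regular graphs on $n$ vertices with $d_n\to\infty$ and $i\sim j$ means that $i$ and $j$ are connected by an edge in $\mathscr G_n$. (iii) (Erdős–Rényi graphs) For $\beta>0$, $\mathbf A_n(i,j)=\frac\beta{np_n}\mathbf 1(i\sim j)$, where $i\sim j$ denotes adjacency in the Erdős–Rényi random graph $\mathscr G(n,p_n)$ on $n$ vertices with edge probability $p_n\in[0,1]$, and $np_n\gg\sqrt{\frac{\log n}{\log\log n}}$. (iv) (Graphon models) Let $W:[0,1]^2\to[0,1]$ be a symmetric function. Given $W$, consider the graph on $n$ vertices with edge indicators $E_{ij}$ sampled as follows: $U_i$ are i.i.d. $U(0,1)$ and $E_{ij}\sim\mathrm{Bern}(\rho_nW(U_i,U_j))$ independently for $i<j$. For $\beta>0$, $\mathbf A_n(i,j)=\frac\beta{n\rho_n}E_{ij}$, with $n\rho_n\gg\sqrt{\frac{\log n}{\log\log n}}$.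
   Context: $\|\cdot\|$ is the operator norm and $\mathrm{Tr}$ the trace; asymptotics are as $n\to\infty$; $a_n\gg b_n$ means $a_n/b_n\to\infty$; $\mathbf 1$ (without argument) is the all-ones vector of length $n$, $\mathbf 1(\cdot)$ is an indicator, and $\mathbf I_n$ is the $n\times n$ identity. Graphs are simple and undirected, so $\mathbf A_n$ is symmetric with zero diagonal (in (iv), $E_{ji}=E_{ij}$ and $E_{ii}=0$). *)

theory Defs
  imports
    "HOL-Probability.Probability"
    "HOL-Library.Landau_Symbols"
    "Jordan_Normal_Form.Matrix"
begin

section \<open>Matrices\<close>

definition trace_mat :: "real mat \<Rightarrow> real" where
  "trace_mat A = (\<Sum>i<dim_row A. A $$ (i, i))"

definition euclid_norm :: "real vec \<Rightarrow> real" where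
  "euclid_norm v = L2_set (vec_index v) {..<dim_vec v}"

definition op_norm :: "real mat \<Rightarrow> real" where
  "op_norm A = Sup {euclid_norm (A *\<^sub>v v) | v. v \<in> carrier_vec (dim_col A) \<and> euclid_norm v \<le> 1}"

definition all_ones :: "nat \<Rightarrow> real mat" where
  \<comment> \<open>the all-ones vector, as an \<open>n \<times> 1\<close> matrix\<close>
  "all_ones n = mat n 1 (\<lambda>_. 1)"

section \<open>Graphs\<close>

text \<open>
  A simple undirected graph on the vertex set \<open>{..<n}\<close> (matching the 0-based matrix indices)
  is given by its set of edges, each of them a two-element set of vertices.
\<close>

definition simple_graph :: "nat \<Rightarrow> nat set set \<Rightarrow> bool" where
  "simple_graph n E \<longleftrightarrow> (\<forall>e\<in>E. e \<subseteq> {..<n} \<and> card e = 2)"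

definition regular_graph :: "nat \<Rightarrow> nat \<Rightarrow> nat set set \<Rightarrow> bool" where
  "regular_graph n d E \<longleftrightarrow> simple_graph n E \<and> (\<forall>i<n. card {j. {i, j} \<in> E} = d)"

definition scaled_adjacency :: "nat \<Rightarrow> real \<Rightarrow> nat set set \<Rightarrow> real mat" where
  "scaled_adjacency n c E = mat n n (\<lambda>(i, j). c * of_bool ({i, j} \<in> E))"

lemma scaled_adjacency_carrier: "scaled_adjacency n c E \<in> carrier_mat n n"
  by (simp add: scaled_adjacency_def)

lemma scaled_adjacency_symmetric: "(scaled_adjacency n c E)\<^sup>T = scaled_adjacency n c E"
  by (auto simp: scaled_adjacency_def insert_commute)

lemma scaled_adjacency_diag:
  assumes "simple_graph n E" "i < n"
  shows "scaled_adjacency n c E $$ (i, i) = 0"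
  using assms by (auto simp: scaled_adjacency_def simple_graph_def)

section \<open>Random graphs\<close>

definition bernoulli_graph :: "nat \<Rightarrow> (nat \<Rightarrow> nat \<Rightarrow> real) \<Rightarrow> nat set set pmf" where
  \<comment> \<open>the edges \<open>{i, j}\<close>, \<open>i < j < n\<close>, are present independently, with probability \<open>q i j\<close>\<close>
  "bernoulli_graph n q =
     map_pmf (\<lambda>X. {{i, j} | i j. X (i, j)})
       (Pi_pmf {(i, j). i < j \<and> j < n} False (\<lambda>(i, j). bernoulli_pmf (q i j)))"

definition erdos_renyi :: "nat \<Rightarrow> real \<Rightarrow> nat set set pmf" where
  "erdos_renyi n p = bernoulli_graph n (\<lambda>_ _. p)"

definition graphon :: "(real \<Rightarrow> real \<Rightarrow> real) \<Rightarrow> bool" where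
  \<comment> \<open>only the values on the unit square matter\<close>
  "graphon W \<longleftrightarrow>
     case_prod W \<in> borel_measurable (restrict_space borel ({0..1} \<times> {0..1})) \<and>
     (\<forall>x\<in>{0..1}. \<forall>y\<in>{0..1}. W x y \<in> {0..1} \<and> W x y = W y x)"

definition graphon_graph :: "nat \<Rightarrow> real \<Rightarrow> (real \<Rightarrow> real \<Rightarrow> real) \<Rightarrow> nat set set measure" where
  \<comment> \<open>first draw the \<open>U\<^sub>i\<close> i.i.d. uniform on the unit interval, then, given these, the edges\<close>
  "graphon_graph n \<rho> W =
     (\<Pi>\<^sub>M i\<in>{..<n}. restrict_space lborel {0..1}) \<bind>
       (\<lambda>u. measure_pmf (bernoulli_graph n (\<lambda>i j. \<rho> * W (u i) (u j))))"

lemma measure_pmf_eq_sum: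
  assumes "finite S" "set_pmf p \<subseteq> S"
  shows "emeasure (measure_pmf p) A = (\<Sum>x\<in>S \<inter> A. ennreal (pmf p x))"
proof -
  have "emeasure (measure_pmf p) A = emeasure (measure_pmf p) (S \<inter> A)"
    using assms(2) by (intro emeasure_eq_AE) (auto simp: AE_measure_pmf_iff)
  also have "\<dots> = (\<Sum>x\<in>S \<inter> A. ennreal (pmf p x))"
    using assms(1) by (subst emeasure_measure_pmf_finite) auto
  finally show ?thesis .
qed

lemma graphon_kernel_measurable:
  assumes W: "graphon W"
  shows "(\<lambda>u. measure_pmf (bernoulli_graph n (\<lambda>i j. \<rho> * W (u i) (u j))))
           \<in> (\<Pi>\<^sub>M i\<in>{..<n}. restrict_space lborel {0..1}) \<rightarrow>\<^sub>M subprob_algebra (count_space UNIV)"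
    (is "?K \<in> ?M \<rightarrow>\<^sub>M _")
proof -
  define I :: "(nat \<times> nat) set" where "I = {(i, j). i < j \<and> j < n}"
  define g :: "(nat \<times> nat \<Rightarrow> bool) \<Rightarrow> nat set set" where "g = (\<lambda>X. {{i, j} | i j. X (i, j)})"
  define P where "P u = Pi_pmf I False (\<lambda>(i, j). bernoulli_pmf (\<rho> * W (u i) (u j)))" for u
  define S where "S = PiE_dflt I False (\<lambda>_. UNIV :: bool set)"
  have "finite I"
    by (rule finite_subset[of _ "{..<n} \<times> {..<n}"]) (auto simp: I_def)
  then have "finite S"
    unfolding S_def by (intro finite_PiE_dflt) auto
  have setP: "set_pmf (P u) \<subseteq> S" for u
    unfolding P_def S_def using \<open>finite I\<close> by (auto simp: set_Pi_pmf PiE_dflt_def)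
  have K: "emeasure (?K u) A = (\<Sum>X\<in>S \<inter> g -` A. ennreal (pmf (P u) X))" for u A
  proof -
    have "?K u = measure_pmf (map_pmf g (P u))"
      unfolding bernoulli_graph_def I_def g_def P_def ..
    then show ?thesis
      using measure_pmf_eq_sum[OF \<open>finite S\<close> setP] by simp
  qed
  have Wm: "(\<lambda>u. W (u i) (u j)) \<in> borel_measurable ?M" if "i < n" "j < n" for i j
  proof -
    have proj: "(\<lambda>u. u k) \<in> ?M \<rightarrow>\<^sub>M restrict_space lborel {0..1}" if "k < n" for k
      using that by (intro measurable_component_singleton) auto
    then have proj': "(\<lambda>u. u k) \<in> borel_measurable ?M" if "k < n" for k
      using proj[OF that] by (simp add: measurable_restrict_space2_iff)
    have "(\<lambda>u. (u i, u j)) \<in> ?M \<rightarrow>\<^sub>M restrict_space borel ({0..1} \<times> {0..1})"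
    proof (rule measurable_restrict_space2)
      show "(\<lambda>u. (u i, u j)) \<in> space ?M \<rightarrow> {0..1} \<times> {0..1}"
        using that by (auto simp: space_PiM space_restrict_space PiE_iff)
      show "(\<lambda>u. (u i, u j)) \<in> borel_measurable ?M"
        using proj' that by (intro borel_measurable_Pair) auto
    qed
    then show ?thesis
      using W unfolding graphon_def
      by (auto dest: measurable_compose[where g = "case_prod W"])
  qed
  have Pm: "(\<lambda>u. ennreal (pmf (P u) X)) \<in> borel_measurable ?M" if "X \<in> S" for X
  proof -
    have b: "pmf (bernoulli_pmf p) x
          = (if x then min 1 (max 0 p) else 1 - min 1 (max 0 p))" for p x
      by (cases x; simp add: bernoulli_pmf.rep_eq)
    have "pmf (P u) X = (\<Prod>(i, j)\<in>I. pmf (bernoulli_pmf (\<rho> * W (u i) (u j))) (X (i, j)))" for u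
      unfolding P_def using \<open>finite I\<close> that
      by (subst pmf_Pi) (auto simp: S_def PiE_dflt_def case_prod_unfold)
    moreover have "(\<lambda>u. \<Prod>(i, j)\<in>I. pmf (bernoulli_pmf (\<rho> * W (u i) (u j))) (X (i, j)))
        \<in> borel_measurable ?M"
      unfolding b case_prod_unfold
      by (intro borel_measurable_prod) (auto simp: I_def intro!: measurable_If Wm
            borel_measurable_min borel_measurable_max borel_measurable_diff borel_measurable_times)
    ultimately show ?thesis by simp
  qed
  show ?thesis
  proof (rule measurable_subprob_algebra)
    show "subprob_space (?K u)" for u
      by (rule measure_pmf.subprob_space_axioms)
    show "(\<lambda>u. emeasure (?K u) A) \<in> borel_measurable ?M" for A
      unfolding K by (intro borel_measurable_sum Pm) auto
  qed simp
qed

lemma prob_space_graphon_graph: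
  assumes "graphon W"
  shows "prob_space (graphon_graph n \<rho> W)"
proof -
  have "prob_space (restrict_space lborel {0..1::real})"
    by (intro prob_spaceI) (simp add: space_restrict_space emeasure_restrict_space)
  then have "prob_space (\<Pi>\<^sub>M i\<in>{..<n}. restrict_space lborel {0..1::real})"
    by (intro prob_space_PiM)
  then show ?thesis
    unfolding graphon_graph_def
    by (rule prob_space.prob_space_bind[OF _ _ graphon_kernel_measurable[OF assms]])
       (simp add: measure_pmf.prob_space_axioms)
qed

section \<open>Asymptotics\<close>

text \<open>
  For a sequence of random quantities \<open>X n\<close>, each on its own probability space \<open>M n\<close>, the
  statements \<open>X n = O(1)\<close> and \<open>X n = o(r n)\<close> are understood with high probability, i.e. with
  probability tending to one; the constant in the former is deterministic.
\<close>

definition bounded_whp :: "(nat \<Rightarrow> 'a measure) \<Rightarrow> (nat \<Rightarrow> 'a \<Rightarrow> real) \<Rightarrow> bool" where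
  "bounded_whp M X \<longleftrightarrow>
     (\<exists>C. (\<lambda>n. measure (M n) {\<omega>\<in>space (M n). \<bar>X n \<omega>\<bar> \<le> C}) \<longlonglongrightarrow> 1)"

definition smallo_whp :: "(nat \<Rightarrow> 'a measure) \<Rightarrow> (nat \<Rightarrow> 'a \<Rightarrow> real) \<Rightarrow> (nat \<Rightarrow> real) \<Rightarrow> bool" where
  "smallo_whp M X r \<longleftrightarrow>
     (\<forall>\<epsilon>>0. (\<lambda>n. measure (M n) {\<omega>\<in>space (M n). \<bar>X n \<omega>\<bar> \<le> \<epsilon> * \<bar>r n\<bar>}) \<longlonglongrightarrow> 1)"

definition much_greater :: "(nat \<Rightarrow> real) \<Rightarrow> (nat \<Rightarrow> real) \<Rightarrow> bool" (infix "\<ggreater>" 50) where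
  "a \<ggreater> b \<longleftrightarrow> filterlim (\<lambda>n. a n / b n) at_top sequentially"

end

theory Submission
  imports Defs "HOL-Real_Asymp.Real_Asymp"
begin

text \<open>
  All four cases rest on one principle: the operator norm of a symmetric matrix with nonnegative
  entries is controlled by row sums. For complete and regular graphs the row sums are at most
  \<open>\<beta>\<close>, so Schur's test bounds the norm, and the trace of the square, a sum of squared
  entries, is \<open>O(1)\<close> and \<open>\<beta>\<^sup>2 n / d\<^sub>n\<close> respectively.

  For the random graphs write \<open>d = n p\<close>, where \<open>p\<close> bounds all edge probabilities. The trace of the
  square is a multiple of the number of edges, with expectation at most \<open>2 \<beta>\<^sup>2 n / d\<close>, and
  Markov's inequality suffices as \<open>d \<rightarrow> \<infinity>\<close>. The norm is the substance. For small \<open>d\<close> the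
  maximal degree is of order \<open>ln n / ln (ln n)\<close>, far above \<open>d\<close>, so row sums alone do not
  suffice; but a star with \<open>D\<close> edges has norm only \<open>sqrt D\<close>, and for a star of maximal degree this
  is \<open>O(d)\<close> precisely when \<open>d\<close> is at least of order \<open>sqrt (ln n / ln (ln n))\<close>. To make this rigorous, orient every
  edge \<open>{i, j}\<close> with \<open>i < j\<close> from \<open>i\<close> to \<open>j\<close>. This writes the adjacency matrix as \<open>U + U\<^sup>T\<close>
  where \<open>U\<close> has independent entries, hence independent rows. Call a row heavy if it has more than
  \<open>10 d\<close> ones. The part of \<open>U\<close> in light rows and light columns has norm at most \<open>10 d\<close> by
  Schur's test. The part \<open>B\<close> in heavy rows satisfies \<open>\<parallel>B\<parallel>\<^sup>2 = \<parallel>B B\<^sup>T\<parallel>\<close>, which is at most the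
  largest row sum of \<open>B B\<^sup>T\<close>: the number of ones in a heavy row plus its total overlap with the
  other heavy rows. If both are at most \<open>d\<^sup>2\<close> (the predicate \<open>controlled\<close>), and likewise for
  columns, then the norm of the adjacency matrix is \<open>O(d)\<close>
  (lemma \<open>controlled_bilinear_bound\<close>).

  Rows are controlled with high probability (lemma \<open>prob_not_controlled\<close>). That no row has
  more than \<open>d\<^sup>2\<close> ones is a Chernoff bound. For the overlaps, condition on one row and
  let \<open>S\<close> be the set of its ones: the overlaps of \<open>S\<close> with the other heavy rows are
  independent, and each is nonzero with tiny probability, because being heavy costs a factor
  \<open>exp (- 8 d)\<close> and meeting \<open>S\<close> costs about \<open>p |S| \<le> d\<^sup>3 / n\<close>. Their joint moment generating function at
  \<open>\<theta> = 3 ln n / d\<^sup>2\<close> therefore stays bounded, and the total overlap exceeds \<open>d\<^sup>2\<close> with probability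
  \<open>O(n\<^sup>-\<^sup>3)\<close>, so a union bound over the rows applies. When \<open>d > ln n\<close> it is already enough that
  heavy rows are unlikely.

  All estimates are uniform in the edge probabilities below \<open>p\<close>. Hence they hold for the graphon
  model conditionally on the positions of the vertices, with \<open>p = min 1 \<rho>\<^sub>n\<close>, and integrating over
  the positions preserves them (lemma \<open>measure_graphon_graph_le\<close>).
\<close>

section \<open>Operator norms and bilinear forms\<close>

text \<open>
  Testing the bilinear form on \<open>x = A v / \<parallel>A v\<parallel>\<close> and \<open>y = v\<close> gives \<open>\<parallel>A v\<parallel>\<close>. A bound on the form also
  makes the supremum that defines the norm one of a bounded set, which is what gives
  nonnegativity.
\<close>
lemma bilinear_bound_imp_op_norm:
  assumes A: "A \<in> carrier_mat n n"
    and B: "\<And>x y. (\<Sum>i<n. (x i)\<^sup>2) \<le> 1 \<Longrightarrow> (\<Sum>j<n. (y j)\<^sup>2) \<le> 1 \<Longrightarrow>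
              (\<Sum>i<n. \<Sum>j<n. A $$ (i, j) * x i * y j) \<le> C"
  shows "0 \<le> op_norm A" "op_norm A \<le> C"
proof -
  have C: "0 \<le> C" using B[of "\<lambda>_. 0" "\<lambda>_. 0"] by simp
  define T where "T = {euclid_norm (A *\<^sub>v v) | v. v \<in> carrier_vec (dim_col A) \<and> euclid_norm v \<le> 1}"
  have le: "t \<le> C" if tT: "t \<in> T" for t
  proof -
    obtain v where v: "v \<in> carrier_vec n" "euclid_norm v \<le> 1" and t: "t = euclid_norm (A *\<^sub>v v)"
      using tT A by (auto simp: T_def)
    define u where "u i = vec_index (A *\<^sub>v v) i" for i
    define y where "y = vec_index v"
    have u: "u i = (\<Sum>j<n. A $$ (i, j) * y j)" if "i < n" for i
      using that A v by (auto simp: u_def y_def scalar_prod_def atLeast0LessThan intro!: sum.cong)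
    have tN: "t = sqrt (\<Sum>i<n. (u i)\<^sup>2)"
      using A by (simp add: t euclid_norm_def L2_set_def u_def)
    have y: "(\<Sum>j<n. (y j)\<^sup>2) \<le> 1"
      using v by (simp add: euclid_norm_def L2_set_def y_def)
    show ?thesis
    proof (cases "t = 0")
      case False
      have t0: "t > 0" using False tN by (metis less_eq_real_def real_sqrt_ge_zero sum_nonneg zero_le_power2)
      have t2: "t\<^sup>2 = (\<Sum>i<n. (u i)\<^sup>2)" by (simp add: tN sum_nonneg)
      have "(\<Sum>i<n. (u i / t)\<^sup>2) = 1"
        using t0 by (simp add: power_divide flip: sum_divide_distrib t2)
      then have "(\<Sum>i<n. \<Sum>j<n. A $$ (i, j) * (u i / t) * y j) \<le> C"
        by (intro B y) simp
      also have "(\<Sum>i<n. \<Sum>j<n. A $$ (i, j) * (u i / t) * y j) = (\<Sum>i<n. (u i)\<^sup>2 / t)"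
      proof (intro sum.cong refl)
        fix i assume "i \<in> {..<n}"
        then have ui: "(\<Sum>j<n. A $$ (i, j) * y j) = u i" using u by simp
        have "(\<Sum>j<n. A $$ (i, j) * (u i / t) * y j) = (u i / t) * (\<Sum>j<n. A $$ (i, j) * y j)"
          by (simp add: sum_distrib_left mult_ac)
        then show "(\<Sum>j<n. A $$ (i, j) * (u i / t) * y j) = (u i)\<^sup>2 / t"
          by (simp add: ui power2_eq_square)
      qed
      also have "\<dots> = t\<^sup>2 / t" by (simp add: t2 sum_divide_distrib)
      also have "\<dots> = t" using t0 by (simp add: power2_eq_square)
      finally show ?thesis .
    qed (use C in simp)
  qed
  have op: "op_norm A = Sup T" by (simp add: op_norm_def T_def)
  have "euclid_norm (A *\<^sub>v 0\<^sub>v n) \<in> T"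
  proof -
    have "0\<^sub>v n \<in> carrier_vec (dim_col A)" "euclid_norm (0\<^sub>v n) \<le> 1"
      using A by (simp_all add: euclid_norm_def L2_set_def)
    then show ?thesis unfolding T_def by blast
  qed
  moreover have "euclid_norm (A *\<^sub>v 0\<^sub>v n) \<ge> 0"
    by (simp add: euclid_norm_def)
  moreover have "bdd_above T" using le by (rule bdd_aboveI)
  ultimately show "0 \<le> op_norm A" unfolding op by (metis cSup_upper order_trans)
  show "op_norm A \<le> C" unfolding op using le \<open>_ \<in> T\<close> by (intro cSup_least) auto
qed

lemma sum_of_bool_mem:
  assumes "S \<subseteq> {..<n::nat}"
  shows "(\<Sum>j<n. of_bool (j \<in> S)) = real (card S)"
  using assms by (simp add: of_bool_def sum.If_cases Int_absorb1)

lemma mult_le_half_sum_squares: "a * b \<le> (a\<^sup>2 + b\<^sup>2) / (2::real)"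
  using sum_squares_bound[of a b] by simp

text \<open>
  Schur's test: bound each \<open>x i * y j\<close> by the mean of the squares, and sum the squares first along
  rows and columns.
\<close>
lemma schur_bilinear_bound:
  fixes B :: "nat \<Rightarrow> nat \<Rightarrow> real"
  assumes B0: "\<And>i j. i < n \<Longrightarrow> j < n \<Longrightarrow> B i j \<ge> 0"
    and row: "\<And>i. i < n \<Longrightarrow> (\<Sum>j<n. B i j) \<le> C"
    and col: "\<And>j. j < n \<Longrightarrow> (\<Sum>i<n. B i j) \<le> C"
    and C: "C \<ge> 0"
    and x: "(\<Sum>i<n. (x i)\<^sup>2) \<le> 1" and y: "(\<Sum>j<n. (y j)\<^sup>2) \<le> 1"
  shows "(\<Sum>i<n. \<Sum>j<n. B i j * x i * y j) \<le> C"
proof -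
  have "(\<Sum>i<n. \<Sum>j<n. B i j * x i * y j) \<le> (\<Sum>i<n. \<Sum>j<n. B i j * (((x i)\<^sup>2 + (y j)\<^sup>2) / 2))"
    using B0 by (intro sum_mono) (metis lessThan_iff mult.assoc mult_left_mono mult_le_half_sum_squares)
  also have "\<dots> = (\<Sum>i<n. \<Sum>j<n. (x i)\<^sup>2 * B i j / 2 + (y j)\<^sup>2 * B i j / 2)"
    by (intro sum.cong refl) (simp add: field_simps)
  also have "\<dots> = ((\<Sum>i<n. (x i)\<^sup>2 * (\<Sum>j<n. B i j)) + (\<Sum>i<n. \<Sum>j<n. (y j)\<^sup>2 * B i j)) / 2"
    by (simp add: sum.distrib add_divide_distrib sum_divide_distrib sum_distrib_left)
  also have "(\<Sum>i<n. \<Sum>j<n. (y j)\<^sup>2 * B i j) = (\<Sum>j<n. (y j)\<^sup>2 * (\<Sum>i<n. B i j))"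
    by (subst sum.swap) (simp add: sum_distrib_left)
  also have "((\<Sum>i<n. (x i)\<^sup>2 * (\<Sum>j<n. B i j)) + (\<Sum>j<n. (y j)\<^sup>2 * (\<Sum>i<n. B i j))) / 2
      \<le> ((\<Sum>i<n. (x i)\<^sup>2 * C) + (\<Sum>j<n. (y j)\<^sup>2 * C)) / 2"
    using row col by (intro divide_right_mono add_mono sum_mono mult_left_mono) auto
  also have "\<dots> = ((\<Sum>i<n. (x i)\<^sup>2) * C + (\<Sum>j<n. (y j)\<^sup>2) * C) / 2"
    by (simp add: sum_distrib_right)
  also have "\<dots> \<le> (1 * C + 1 * C) / 2"
    using x y C by (intro divide_right_mono add_mono mult_right_mono) auto
  finally show ?thesis by simp
qed

section \<open>Relations with few and barely overlapping heavy rows\<close>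

text \<open>
  The constant 10 leaves room: the exponential moment of a row with mean \<open>d\<close> is at most
  \<open>exp (2 d)\<close>, so being heavy has probability at most \<open>exp (- 8 d)\<close>, and this still absorbs
  \<open>exp (6 d)\<close> times \<open>n\<close> when \<open>d \<ge> ln n\<close>.
\<close>
definition heavy :: "real \<Rightarrow> (nat \<times> nat) set \<Rightarrow> nat set" where
  "heavy d F = {v. 10 * d < real (card (F `` {v}))}"

text \<open>
  Let \<open>M\<close> be the 0-1 matrix of \<open>F\<close>. The cardinalities of \<open>F `` {v} \<inter> F `` {w}\<close> are the entries
  of \<open>M M\<^sup>T\<close>, so the two conditions bound the diagonal and the off-diagonal part of the row sums of
  this matrix restricted to heavy rows.
\<close>
definition controlled :: "nat \<Rightarrow> real \<Rightarrow> (nat \<times> nat) set \<Rightarrow> bool" where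
  "controlled n d F \<longleftrightarrow> (\<forall>v<n. real (card (F `` {v})) \<le> d\<^sup>2 \<and>
     (\<Sum>w\<in>{..<n} \<inter> heavy d F - {v}. real (card (F `` {v} \<inter> F `` {w}))) \<le> d\<^sup>2)"

text \<open>
  With \<open>B\<close> the heavy rows of the matrix of \<open>F\<close>, the rows of \<open>B B\<^sup>T\<close> sum to at most \<open>2 d\<^sup>2\<close>, hence
  \<open>\<parallel>B\<^sup>T x\<parallel>\<^sup>2 \<le> 2 d\<^sup>2\<close> by Schur's test.
\<close>
lemma heavy_rows_bilinear_bound:
  fixes F :: "(nat \<times> nat) set"
  assumes F: "F \<subseteq> {..<n} \<times> {..<n}" and d: "d > 0" and c: "controlled n d F"
    and x: "(\<Sum>i<n. (x i)\<^sup>2) \<le> 1" and y: "(\<Sum>j<n. (y j)\<^sup>2) \<le> 1"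
  shows "(\<Sum>i<n. \<Sum>j<n. of_bool ((i, j) \<in> F \<and> i \<in> heavy d F) * x i * y j) \<le> 3 / 2 * d"
proof -
  define H where "H = {..<n} \<inter> heavy d F"
  have finH: "finite H" by (simp add: H_def)
  define M :: "nat \<Rightarrow> nat \<Rightarrow> real" where "M i j = of_bool ((i, j) \<in> F)" for i j
  \<comment> \<open>\<open>z\<close> is \<open>B\<^sup>T x\<close> and \<open>G\<close> is \<open>M M\<^sup>T\<close>\<close>
  define z where "z j = (\<Sum>i\<in>H. M i j * x i)" for j
  define G where "G i i' = (\<Sum>j<n. M i j * M i' j)" for i i'
  have G: "G i i' = real (card (F `` {i} \<inter> F `` {i'}))" for i i'
  proof -
    have "G i i' = (\<Sum>j<n. of_bool (j \<in> F `` {i} \<inter> F `` {i'}))"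
      unfolding G_def M_def by (intro sum.cong refl) auto
    also have "\<dots> = real (card (F `` {i} \<inter> F `` {i'}))"
      using F by (intro sum_of_bool_mem) auto
    finally show ?thesis .
  qed
  have rowG: "(\<Sum>i'\<in>H. G i i') \<le> 2 * d\<^sup>2" if "i \<in> H" for i
  proof -
    have "i < n" using that by (simp add: H_def)
    have "(\<Sum>i'\<in>H. G i i') = G i i + (\<Sum>i'\<in>H - {i}. G i i')"
      using finH that by (simp add: sum.remove)
    also have "\<dots> \<le> d\<^sup>2 + d\<^sup>2"
      using c \<open>i < n\<close> unfolding controlled_def G H_def by (intro add_mono) auto
    finally show ?thesis by simp
  qed
  have Gsym: "G i i' = G i' i" for i i' by (simp add: G_def mult.commute)
  have G0: "G i i' \<ge> 0" for i i' by (simp add: G)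
  have xH: "(\<Sum>i\<in>H. (x i)\<^sup>2) \<le> 1"
    by (rule order_trans[OF sum_mono2 x]) (auto simp: H_def)
  have zz: "(\<Sum>j<n. (z j)\<^sup>2) \<le> 2 * d\<^sup>2"
  proof -
    have "(\<Sum>j<n. (z j)\<^sup>2) = (\<Sum>j<n. \<Sum>i\<in>H. \<Sum>i'\<in>H. (M i j * x i) * (M i' j * x i'))"
      by (simp add: z_def power2_eq_square sum_product)
    also have "\<dots> = (\<Sum>i\<in>H. \<Sum>i'\<in>H. \<Sum>j<n. (M i j * x i) * (M i' j * x i'))"
      by (subst sum.swap, rule sum.cong[OF refl], rule sum.swap)
    also have "\<dots> = (\<Sum>i\<in>H. \<Sum>i'\<in>H. G i i' * (x i * x i'))"
      by (simp add: G_def sum_distrib_left sum_distrib_right mult_ac)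
    also have "\<dots> \<le> (\<Sum>i\<in>H. \<Sum>i'\<in>H. G i i' * (((x i)\<^sup>2 + (x i')\<^sup>2) / 2))"
      using G0 by (intro sum_mono mult_left_mono mult_le_half_sum_squares)
    also have "\<dots> = ((\<Sum>i\<in>H. \<Sum>i'\<in>H. G i i' * (x i)\<^sup>2) + (\<Sum>i\<in>H. \<Sum>i'\<in>H. G i i' * (x i')\<^sup>2)) / 2"
      by (simp add: distrib_left sum.distrib add_divide_distrib sum_divide_distrib)
    also have "(\<Sum>i\<in>H. \<Sum>i'\<in>H. G i i' * (x i')\<^sup>2) = (\<Sum>i\<in>H. \<Sum>i'\<in>H. G i i' * (x i)\<^sup>2)"
      by (subst sum.swap) (simp add: Gsym)
    also have "((\<Sum>i\<in>H. \<Sum>i'\<in>H. G i i' * (x i)\<^sup>2) + (\<Sum>i\<in>H. \<Sum>i'\<in>H. G i i' * (x i)\<^sup>2)) / 2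
        = (\<Sum>i\<in>H. (x i)\<^sup>2 * (\<Sum>i'\<in>H. G i i'))"
      by (simp add: sum_distrib_left sum_distrib_right mult_ac)
    also have "\<dots> \<le> (\<Sum>i\<in>H. (x i)\<^sup>2 * (2 * d\<^sup>2))"
      using rowG by (intro sum_mono mult_left_mono) auto
    also have "\<dots> = (\<Sum>i\<in>H. (x i)\<^sup>2) * (2 * d\<^sup>2)" by (simp add: sum_distrib_right)
    also have "\<dots> \<le> 1 * (2 * d\<^sup>2)" using xH by (intro mult_right_mono) auto
    finally show ?thesis by simp
  qed
  have "(\<Sum>i<n. \<Sum>j<n. of_bool ((i, j) \<in> F \<and> i \<in> heavy d F) * x i * y j)
      = (\<Sum>j<n. \<Sum>i<n. if i \<in> heavy d F then M i j * x i * y j else 0)"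
    by (subst sum.swap, intro sum.cong refl) (auto simp: M_def)
  also have "\<dots> = (\<Sum>j<n. y j * z j)"
    by (simp add: sum.inter_restrict[symmetric] H_def[symmetric] z_def sum_distrib_left mult_ac)
  also have "\<dots> \<le> (\<Sum>j<n. d / 2 * (y j)\<^sup>2 + 1 / (2 * d) * (z j)\<^sup>2)"
  proof (rule sum_mono)
    fix j
    \<comment> \<open>weights chosen so that both halves are of order \<open>d\<close> after summation\<close>
    have "y j * z j = d * (y j * (z j / d))" using d by simp
    also have "\<dots> \<le> d * (((y j)\<^sup>2 + (z j / d)\<^sup>2) / 2)"
      using d by (intro mult_left_mono mult_le_half_sum_squares) auto
    also have "\<dots> = d / 2 * (y j)\<^sup>2 + 1 / (2 * d) * (z j)\<^sup>2"
      using d by (simp add: field_simps power2_eq_square)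
    finally show "y j * z j \<le> d / 2 * (y j)\<^sup>2 + 1 / (2 * d) * (z j)\<^sup>2" .
  qed
  also have "\<dots> = d / 2 * (\<Sum>j<n. (y j)\<^sup>2) + 1 / (2 * d) * (\<Sum>j<n. (z j)\<^sup>2)"
    by (simp add: sum.distrib sum_distrib_left)
  also have "\<dots> \<le> d / 2 * 1 + 1 / (2 * d) * (2 * d\<^sup>2)"
    using d y zz by (intro add_mono mult_left_mono) auto
  also have "\<dots> = 3 / 2 * d" using d by (simp add: power2_eq_square)
  finally show ?thesis .
qed

text \<open>
  Split the pairs into those in a heavy row, those in a light row and a heavy column, and
  those in a light row and a light column. The second class is a family of heavy rows of
  \<open>F\<inverse>\<close> once the vector \<open>x\<close> is set to zero on the heavy rows of \<open>F\<close>.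
\<close>
lemma controlled_bilinear_bound:
  fixes F :: "(nat \<times> nat) set"
  assumes F: "F \<subseteq> {..<n} \<times> {..<n}" and d: "d > 0"
    and c: "controlled n d F" and c': "controlled n d (F\<inverse>)"
    and x: "(\<Sum>i<n. (x i)\<^sup>2) \<le> 1" and y: "(\<Sum>j<n. (y j)\<^sup>2) \<le> 1"
  shows "(\<Sum>i<n. \<Sum>j<n. of_bool ((i, j) \<in> F) * x i * y j) \<le> 13 * d"
proof -
  define H where "H = heavy d F"
  define K where "K = heavy d (F\<inverse>)"
  define x' where "x' i = (if i \<in> H then 0 else x i)" for i
  define B :: "nat \<Rightarrow> nat \<Rightarrow> real" where "B i j = of_bool ((i, j) \<in> F \<and> i \<notin> H \<and> j \<notin> K)" for i j
  have F': "F\<inverse> \<subseteq> {..<n} \<times> {..<n}" using F by auto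
  have x': "(\<Sum>i<n. (x' i)\<^sup>2) \<le> 1"
    by (rule order_trans[OF sum_mono x]) (auto simp: x'_def)
  have 1: "(\<Sum>i<n. \<Sum>j<n. of_bool ((i, j) \<in> F \<and> i \<in> H) * x i * y j) \<le> 3 / 2 * d"
    unfolding H_def by (rule heavy_rows_bilinear_bound[OF F d c x y])
  have "(\<Sum>j<n. \<Sum>i<n. of_bool ((j, i) \<in> F\<inverse> \<and> j \<in> K) * y j * x' i) \<le> 3 / 2 * d"
    unfolding K_def by (rule heavy_rows_bilinear_bound[OF F' d c' y x'])
  then have 2: "(\<Sum>i<n. \<Sum>j<n. of_bool ((i, j) \<in> F \<and> i \<notin> H \<and> j \<in> K) * x i * y j) \<le> 3 / 2 * d"
    by (subst (asm) sum.swap, elim order_trans[rotated], intro eq_refl sum.cong refl)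
       (auto simp: x'_def)
  have 3: "(\<Sum>i<n. \<Sum>j<n. B i j * x i * y j) \<le> 10 * d"
  proof (rule schur_bilinear_bound[OF _ _ _ _ x y])
    fix i assume "i < n"
    show "(\<Sum>j<n. B i j) \<le> 10 * d"
    proof (cases "i \<in> H")
      case False
      have "(\<Sum>j<n. B i j) \<le> (\<Sum>j<n. of_bool (j \<in> F `` {i}))"
        by (intro sum_mono) (auto simp: B_def)
      also have "\<dots> = real (card (F `` {i}))" using F by (intro sum_of_bool_mem) auto
      also have "real (card (F `` {i})) \<le> 10 * d" using False by (simp add: H_def heavy_def)
      finally show ?thesis .
    qed (use d in \<open>simp add: B_def\<close>)
  next
    fix j assume "j < n"
    show "(\<Sum>i<n. B i j) \<le> 10 * d"
    proof (cases "j \<in> K")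
      case False
      have "(\<Sum>i<n. B i j) \<le> (\<Sum>i<n. of_bool (i \<in> F\<inverse> `` {j}))"
        by (intro sum_mono) (auto simp: B_def)
      also have "\<dots> = real (card (F\<inverse> `` {j}))" using F by (intro sum_of_bool_mem) auto
      also have "real (card (F\<inverse> `` {j})) \<le> 10 * d" using False by (simp add: K_def heavy_def)
      finally show ?thesis .
    qed (use d in \<open>simp add: B_def\<close>)
  qed (use d in \<open>auto simp: B_def\<close>)
  have "(\<Sum>i<n. \<Sum>j<n. of_bool ((i, j) \<in> F) * x i * y j)
     = (\<Sum>i<n. \<Sum>j<n. of_bool ((i, j) \<in> F \<and> i \<in> H) * x i * y j
          + of_bool ((i, j) \<in> F \<and> i \<notin> H \<and> j \<in> K) * x i * y j + B i j * x i * y j)"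
    by (intro sum.cong refl) (auto simp: B_def)
  also have "\<dots> \<le> 3 / 2 * d + 3 / 2 * d + 10 * d"
    using 1 2 3 by (simp add: sum.distrib)
  finally show ?thesis by simp
qed

lemma of_bool_edge:
  fixes F :: "(nat \<times> nat) set"
  assumes F: "F \<subseteq> {(i, j). i < j \<and> j < n}" and E: "E = {{i, j} | i j. (i, j) \<in> F}"
  shows "of_bool ({i, j} \<in> E) = (of_bool ((i, j) \<in> F) + of_bool ((j, i) \<in> F) :: real)"
proof -
  have "\<not> ((i, j) \<in> F \<and> (j, i) \<in> F)"
  proof
    assume "(i, j) \<in> F \<and> (j, i) \<in> F"
    then have "i < j" "j < i" using F by blast+
    then show False by simp
  qed
  then show ?thesis unfolding E by (auto simp: doubleton_eq_iff)
qed

lemma op_norm_scaled_adjacency_le: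
  assumes d: "d > 0" and c: "c \<ge> 0"
    and F: "F \<subseteq> {(i, j). i < j \<and> j < n}"
    and ctrl: "controlled n d F" "controlled n d (F\<inverse>)"
    and E: "E = {{i, j} | i j. (i, j) \<in> F}"
  shows "0 \<le> op_norm (scaled_adjacency n c E)" "op_norm (scaled_adjacency n c E) \<le> 26 * c * d"
proof -
  have F': "F \<subseteq> {..<n} \<times> {..<n}" using F by force
  note edge = of_bool_edge[OF F E]
  have bil: "(\<Sum>i<n. \<Sum>j<n. scaled_adjacency n c E $$ (i, j) * x i * y j) \<le> 26 * c * d"
    if x: "(\<Sum>i<n. (x i)\<^sup>2) \<le> 1" and y: "(\<Sum>j<n. (y j)\<^sup>2) \<le> 1" for x y
  proof -
    have "(\<Sum>i<n. \<Sum>j<n. scaled_adjacency n c E $$ (i, j) * x i * y j)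
        = (\<Sum>i<n. \<Sum>j<n. c * (of_bool ((i, j) \<in> F) * x i * y j) + c * (of_bool ((j, i) \<in> F) * y j * x i))"
      by (intro sum.cong refl) (simp add: scaled_adjacency_def edge algebra_simps)
    also have "\<dots> = c * (\<Sum>i<n. \<Sum>j<n. of_bool ((i, j) \<in> F) * x i * y j)
        + (\<Sum>i<n. \<Sum>j<n. c * (of_bool ((j, i) \<in> F) * y j * x i))"
      by (simp add: sum.distrib sum_distrib_left)
    also have "(\<Sum>i<n. \<Sum>j<n. c * (of_bool ((j, i) \<in> F) * y j * x i))
        = c * (\<Sum>j<n. \<Sum>i<n. of_bool ((j, i) \<in> F) * y j * x i)"
      by (subst sum.swap) (simp add: sum_distrib_left)
    also have "c * (\<Sum>i<n. \<Sum>j<n. of_bool ((i, j) \<in> F) * x i * y j)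
        + c * (\<Sum>j<n. \<Sum>i<n. of_bool ((j, i) \<in> F) * y j * x i) \<le> c * (13 * d) + c * (13 * d)"
      using c by (intro add_mono mult_left_mono controlled_bilinear_bound[OF F' d ctrl] x y)
    finally show ?thesis by simp
  qed
  show "0 \<le> op_norm (scaled_adjacency n c E)" "op_norm (scaled_adjacency n c E) \<le> 26 * c * d"
    using bilinear_bound_imp_op_norm[OF scaled_adjacency_carrier bil] by auto
qed

section \<open>Complete and regular graphs\<close>

lemma op_norm_nonneg_symmetric_le:
  assumes A: "A \<in> carrier_mat n n"
    and A0: "\<And>i j. i < n \<Longrightarrow> j < n \<Longrightarrow> A $$ (i, j) \<ge> 0"
    and sym: "\<And>i j. i < n \<Longrightarrow> j < n \<Longrightarrow> A $$ (i, j) = A $$ (j, i)"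
    and row: "\<And>i. i < n \<Longrightarrow> (\<Sum>j<n. A $$ (i, j)) \<le> C" and C: "C \<ge> 0"
  shows "0 \<le> op_norm A" "op_norm A \<le> C"
proof -
  have "(\<Sum>i<n. \<Sum>j<n. A $$ (i, j) * x i * y j) \<le> C"
    if "(\<Sum>i<n. (x i)\<^sup>2) \<le> 1" "(\<Sum>j<n. (y j)\<^sup>2) \<le> 1" for x y
  proof (rule schur_bilinear_bound[OF A0 row _ C that])
    fix j assume "j < n"
    then have "(\<Sum>i<n. A $$ (i, j)) = (\<Sum>i<n. A $$ (j, i))" by (intro sum.cong) (auto intro: sym)
    then show "(\<Sum>i<n. A $$ (i, j)) \<le> C" using row[OF \<open>j < n\<close>] by simp
  qed
  from bilinear_bound_imp_op_norm[OF A this] show "0 \<le> op_norm A" "op_norm A \<le> C" by auto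
qed

lemma trace_mat_square:
  assumes "A \<in> carrier_mat n n"
  shows "trace_mat (A ^\<^sub>m 2) = (\<Sum>i<n. \<Sum>j<n. A $$ (i, j) * A $$ (j, i))"
proof -
  have "A ^\<^sub>m 2 = A * A" using assms by (simp add: numeral_2_eq_2)
  then show ?thesis using assms
    by (auto simp: trace_mat_def scalar_prod_def atLeast0LessThan intro!: sum.cong)
qed

lemma complete_graph:
  fixes \<beta> :: real
  assumes b: "\<beta> > 0"
  defines "A \<equiv> (\<lambda>n. (\<beta> / real n) \<cdot>\<^sub>m (all_ones n * (all_ones n)\<^sup>T - 1\<^sub>m n))"
  shows "(\<lambda>n. op_norm (A n)) \<in> O(\<lambda>_. 1)" "(\<lambda>n. trace_mat (A n ^\<^sub>m 2)) \<in> o(\<lambda>n. real n)"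
proof -
  have Ac: "A n \<in> carrier_mat n n" for n
    unfolding A_def by (intro smult_carrier_mat minus_carrier_mat one_carrier_mat)
  have Aij: "A n $$ (i, j) = \<beta> / real n * of_bool (i \<noteq> j)" if "i < n" "j < n" for n i j
    using that by (auto simp: A_def all_ones_def scalar_prod_def)
  have row: "(\<Sum>j<n. A n $$ (i, j)) \<le> \<beta>" if "i < n" for n i
  proof -
    have "(\<Sum>j<n. A n $$ (i, j)) \<le> (\<Sum>j<n. \<beta> / real n)"
      using that b by (intro sum_mono) (auto simp: Aij)
    also have "\<dots> = \<beta>" using that by simp
    finally show ?thesis .
  qed
  have "0 \<le> op_norm (A n) \<and> op_norm (A n) \<le> \<beta>" for n
    using op_norm_nonneg_symmetric_le[OF Ac, of n \<beta>] b row by (auto simp: Aij)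
  then show "(\<lambda>n. op_norm (A n)) \<in> O(\<lambda>_. 1)"
    by (intro bigoI[of _ \<beta>]) auto
  have tr: "\<bar>trace_mat (A n ^\<^sub>m 2)\<bar> \<le> \<beta>\<^sup>2" for n
  proof -
    have "trace_mat (A n ^\<^sub>m 2) = (\<Sum>i<n. \<Sum>j<n. (\<beta> / real n)\<^sup>2 * of_bool (i \<noteq> j))"
      unfolding trace_mat_square[OF Ac] by (intro sum.cong refl) (auto simp: Aij power2_eq_square)
    also have "\<bar>\<dots>\<bar> \<le> (\<Sum>i<n. \<Sum>j<n. (\<beta> / real n)\<^sup>2)"
      by (subst abs_of_nonneg, intro sum_nonneg, simp, intro sum_mono) auto
    also have "\<dots> \<le> \<beta>\<^sup>2" by (simp add: power2_eq_square)
    finally show ?thesis .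
  qed
  have "(\<lambda>n. trace_mat (A n ^\<^sub>m 2)) \<in> O(\<lambda>_. 1)"
    using tr by (intro bigoI[of _ "\<beta>\<^sup>2"]) auto
  moreover have "(\<lambda>_. 1) \<in> o(\<lambda>n. real n)" by real_asymp
  ultimately show "(\<lambda>n. trace_mat (A n ^\<^sub>m 2)) \<in> o(\<lambda>n. real n)"
    by (rule landau_o.big_small_trans)
qed

lemma regular_graphs:
  fixes \<beta> :: real
  assumes b: "\<beta> > 0" and reg: "\<forall>n\<ge>1. regular_graph n (d n) (G n)"
    and d: "filterlim d at_top sequentially"
  defines "A \<equiv> (\<lambda>n. scaled_adjacency n (\<beta> / real (d n)) (G n))"
  shows "(\<lambda>n. op_norm (A n)) \<in> O(\<lambda>_. 1)" "(\<lambda>n. trace_mat (A n ^\<^sub>m 2)) \<in> o(\<lambda>n. real n)"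
proof -
  have Ac: "A n \<in> carrier_mat n n" for n by (simp add: A_def scaled_adjacency_carrier)
  have Aij: "A n $$ (i, j) = \<beta> / real (d n) * of_bool ({i, j} \<in> G n)" if "i < n" "j < n" for n i j
    using that by (auto simp: A_def scaled_adjacency_def)
  have deg: "(\<Sum>j<n. of_bool ({i, j} \<in> G n)) = real (d n)" if "n \<ge> 1" "i < n" for n i
  proof -
    have "(\<Sum>j<n. of_bool ({i, j} \<in> G n)) = real (card ({..<n} \<inter> {j. {i, j} \<in> G n}))"
      by (simp add: sum.If_cases of_bool_def)
    also have "{..<n} \<inter> {j. {i, j} \<in> G n} = {j. {i, j} \<in> G n}"

    proof -
      have "{i, j} \<subseteq> {..<n}" if "{i, j} \<in> G n" for j
      proof -
        have "simple_graph n (G n)" using reg \<open>n \<ge> 1\<close> by (simp add: regular_graph_def)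
        then have "\<forall>e\<in>G n. e \<subseteq> {..<n} \<and> card e = 2" by (simp only: simple_graph_def)
        from bspec[OF this that] show ?thesis by (rule conjunct1)
      qed
      then show ?thesis by auto
    qed
    also have "card \<dots> = d n" using reg that by (auto simp: regular_graph_def)
    finally show ?thesis .
  qed
  have ev: "eventually (\<lambda>n. n \<ge> 1 \<and> d n > 0) sequentially"
    using d[unfolded filterlim_at_top, rule_format, of 1] eventually_ge_at_top[of 1]
    by eventually_elim simp
  have "0 \<le> op_norm (A n) \<and> op_norm (A n) \<le> \<beta>" if n: "n \<ge> 1 \<and> d n > 0" for n
  proof -
    have row: "(\<Sum>j<n. A n $$ (i, j)) \<le> \<beta>" if "i < n" for i
    proof -
      have "(\<Sum>j<n. A n $$ (i, j)) = \<beta> / real (d n) * (\<Sum>j<n. of_bool ({i, j} \<in> G n))"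
        using that by (subst sum_distrib_left) (simp add: Aij)
      then show ?thesis using deg that n by simp
    qed
    show ?thesis using op_norm_nonneg_symmetric_le[OF Ac, of n \<beta>] b row
      by (auto simp: Aij insert_commute)
  qed
  then show "(\<lambda>n. op_norm (A n)) \<in> O(\<lambda>_. 1)"
    using ev by (intro bigoI[of _ \<beta>]) (auto elim!: eventually_mono)
  have tr: "trace_mat (A n ^\<^sub>m 2) / real n = \<beta>\<^sup>2 / real (d n)" if n: "n \<ge> 1 \<and> d n > 0" for n
  proof -
    have "trace_mat (A n ^\<^sub>m 2) = (\<Sum>i<n. (\<beta> / real (d n))\<^sup>2 * (\<Sum>j<n. of_bool ({i, j} \<in> G n)))"
      unfolding trace_mat_square[OF Ac] sum_distrib_left
      by (intro sum.cong refl) (auto simp: Aij power2_eq_square insert_commute)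
    also have "\<dots> = (\<Sum>i<n. (\<beta> / real (d n))\<^sup>2 * real (d n))"
      using n by (intro sum.cong refl) (subst deg, auto)
    finally show ?thesis using n by (simp add: power2_eq_square)
  qed
  have "((\<lambda>n. \<beta>\<^sup>2 / real (d n)) \<longlongrightarrow> 0) sequentially"
    by (rule tendsto_divide_0[OF tendsto_const filterlim_at_top_imp_at_infinity])
       (rule filterlim_compose[OF filterlim_real_sequentially d])
  then have "((\<lambda>n. trace_mat (A n ^\<^sub>m 2) / real n) \<longlongrightarrow> 0) sequentially"
    by (rule Lim_transform_eventually) (use ev tr in \<open>auto elim!: eventually_mono\<close>)
  then show "(\<lambda>n. trace_mat (A n ^\<^sub>m 2)) \<in> o(\<lambda>n. real n)"
    by (intro smalloI_tendsto) (auto intro: eventually_mono[OF eventually_gt_at_top[of 0]])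
qed

section \<open>Independent edges\<close>

text \<open>
  Independence of the coordinates passes to functions of disjoint blocks of coordinates. The blocks
  will be the rows of a random matrix.
\<close>
lemma expectation_prod_blocks:
  fixes g :: "'k \<Rightarrow> ('e \<Rightarrow> bool) \<Rightarrow> real"
  assumes I: "finite I" and L: "finite L"
    and K: "\<And>j. j \<in> L \<Longrightarrow> K j \<subseteq> I" and disj: "disjoint_family_on K L"
    and dep: "\<And>j X Y. j \<in> L \<Longrightarrow> (\<And>e. e \<in> K j \<Longrightarrow> X e = Y e) \<Longrightarrow> g j X = g j Y"
  shows "measure_pmf.expectation (Pi_pmf I dflt p) (\<lambda>X. \<Prod>j\<in>L. g j X)
    = (\<Prod>j\<in>L. measure_pmf.expectation (Pi_pmf I dflt p) (g j))"
proof -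
  let ?P = "Pi_pmf I dflt p"
  let ?indep = "prob_space.indep_vars (measure_pmf ?P)"
  have fin: "finite (set_pmf ?P)"
    by (rule finite_subset[OF set_Pi_pmf_subset'[OF I]]) (intro finite_PiE_dflt I, simp)
  have "?indep (\<lambda>j. PiM (K j) (\<lambda>_. count_space UNIV)) (\<lambda>j X. restrict X (K j)) L"
    by (rule prob_space.indep_vars_restrict[OF measure_pmf.prob_space_axioms indep_vars_Pi_pmf[OF I] K disj])
  then have "?indep (\<lambda>_. borel) (\<lambda>j X. g j (restrict X (K j))) L"
  proof (rule prob_space.indep_vars_compose2[OF measure_pmf.prob_space_axioms])
    fix j assume "j \<in> L"
    then have "finite (K j)" using K I by (blast intro: finite_subset)
    then show "g j \<in> PiM (K j) (\<lambda>_. count_space UNIV) \<rightarrow>\<^sub>M borel"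
      by (subst count_space_PiM_finite) auto
  qed
  moreover have "g j (restrict X (K j)) = g j X" if "j \<in> L" for j X
    by (rule dep[OF that]) simp
  ultimately have "?indep (\<lambda>_. borel) g L"
    by (subst prob_space.indep_vars_cong[OF measure_pmf.prob_space_axioms, where Y = "\<lambda>j X. g j (restrict X (K j))" and J = L]) auto
  then show ?thesis
    by (intro prob_space.indep_vars_lebesgue_integral measure_pmf.prob_space_axioms L) (auto intro: integrable_measure_pmf_finite fin)
qed

lemma prob_le_expectation:
  fixes f :: "'a \<Rightarrow> real"
  assumes "finite (set_pmf P)" "\<And>X. f X \<ge> 0" "\<And>X. Q X \<Longrightarrow> f X \<ge> 1"
  shows "measure_pmf.prob P {X. Q X} \<le> measure_pmf.expectation P f"
proof -
  have "measure_pmf.prob P {X. Q X} = measure_pmf.expectation P (indicator {X. Q X})" by simp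
  also have "\<dots> \<le> measure_pmf.expectation P f"
    using assms by (intro integral_mono integrable_measure_pmf_finite) (auto split: split_indicator)
  finally show ?thesis .
qed

text \<open>
  Independent edges are indexed by an abstract finite set, and \<open>\<phi>\<close> says which entry of the matrix an index
  stands for. Composing \<open>\<phi>\<close> with the swap of coordinates transposes the random
  matrix and leaves the probability space alone; so every statement about rows is also one about
  columns, on the same probability space.
\<close>
locale random_bipartite =
  fixes I :: "'e set" and \<phi> :: "'e \<Rightarrow> nat \<times> nat" and q :: "'e \<Rightarrow> real" and n :: nat and p :: real
  assumes finite_I: "finite I" and inj: "inj_on \<phi> I" and range: "\<phi> ` I \<subseteq> {..<n} \<times> {..<n}"
    and q: "\<And>e. e \<in> I \<Longrightarrow> 0 \<le> q e \<and> q e \<le> p" and p1: "0 \<le> p" "p \<le> 1"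
begin

definition P :: "('e \<Rightarrow> bool) pmf" where "P = Pi_pmf I False (\<lambda>e. bernoulli_pmf (q e))"

abbreviation "\<E> \<equiv> measure_pmf.expectation P"

definition edges :: "('e \<Rightarrow> bool) \<Rightarrow> (nat \<times> nat) set" where "edges X = \<phi> ` {e \<in> I. X e}"

definition row :: "nat \<Rightarrow> 'e set" where "row v = {e \<in> I. fst (\<phi> e) = v}"

definition d :: real where "d = real n * p"

lemma finite_set_P: "finite (set_pmf P)"
  unfolding P_def
  by (rule finite_subset[OF set_Pi_pmf_subset'[OF finite_I]]) (intro finite_PiE_dflt finite_I, simp)

lemma integrable_P [simp]: "integrable (measure_pmf P) (f :: _ \<Rightarrow> real)"
  by (intro integrable_measure_pmf_finite finite_set_P)

lemma row_subset: "row v \<subseteq> I" by (auto simp: row_def)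

lemma finite_row: "finite (row v)" using finite_subset[OF row_subset finite_I] .

lemma inj_on_row: "inj_on (\<lambda>e. snd (\<phi> e)) (row v)"
  using inj by (auto simp: inj_on_def row_def prod_eq_iff)

lemma edges_Image: "edges X `` {v} = (\<lambda>e. snd (\<phi> e)) ` {e \<in> row v. X e}"
proof -
  have "j \<in> edges X `` {v} \<longleftrightarrow> j \<in> (\<lambda>e. snd (\<phi> e)) ` {e \<in> row v. X e}" for j
    unfolding Image_singleton_iff edges_def image_iff row_def by (metis (mono_tags, lifting) mem_Collect_eq prod.collapse fst_conv snd_conv)
  then show ?thesis by blast
qed

lemma edges_subset: "edges X \<subseteq> {..<n} \<times> {..<n}"
  using range by (auto simp: edges_def)

lemma card_edges_Image_Int:
  "real (card (edges X `` {v} \<inter> S)) = (\<Sum>e\<in>row v. of_bool (snd (\<phi> e) \<in> S) * of_bool (X e))"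
proof -
  have "edges X `` {v} \<inter> S = (\<lambda>e. snd (\<phi> e)) ` {e \<in> row v. snd (\<phi> e) \<in> S \<and> X e}"
    by (auto simp: edges_Image)
  also have "card \<dots> = card {e \<in> row v. snd (\<phi> e) \<in> S \<and> X e}"
    by (intro card_image inj_on_subset[OF inj_on_row]) auto
  finally have "real (card (edges X `` {v} \<inter> S)) = (\<Sum>e\<in>{e \<in> row v. snd (\<phi> e) \<in> S \<and> X e}. 1)"
    by simp
  also have "\<dots> = (\<Sum>e\<in>row v. if snd (\<phi> e) \<in> S \<and> X e then 1 else 0)"
    using finite_row by (rule sum.inter_filter)
  also have "\<dots> = (\<Sum>e\<in>row v. of_bool (snd (\<phi> e) \<in> S) * of_bool (X e))"
    by (intro sum.cong) auto
  finally show ?thesis .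
qed

lemma card_edges_Image: "real (card (edges X `` {v})) = (\<Sum>e\<in>row v. of_bool (X e))"
  using card_edges_Image_Int[of X v UNIV] by simp

lemma card_row_le: "card {e \<in> row v. snd (\<phi> e) \<in> S} \<le> card S" if "finite S"
  using that by (intro card_inj_on_le[OF inj_on_subset[OF inj_on_row]]) auto

lemma card_row_le_n: "card (row v) \<le> n"
proof -
  have "card (row v) \<le> card {..<n}"
    by (rule card_inj_on_le[OF inj_on_row]) (use range in \<open>auto simp: row_def\<close>)
  then show ?thesis by simp
qed

lemma edges_Image_cong:
  assumes "\<And>e. e \<in> row v \<Longrightarrow> X e = Y e" shows "edges X `` {v} = edges Y `` {v}"
  using assms by (auto simp: edges_Image)

lemma mgf:
  assumes B: "B \<subseteq> I"
  shows "\<E> (\<lambda>X. exp (\<Sum>e\<in>B. a e * of_bool (X e))) = (\<Prod>e\<in>B. 1 + q e * (exp (a e) - 1))"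
proof -
  have fB: "finite B" using B finite_I by (rule finite_subset)
  define f where "f e b = (if e \<in> B then exp (a e * of_bool b) else 1)" for e b
  have "exp (\<Sum>e\<in>B. a e * of_bool (X e)) = (\<Prod>e\<in>I. f e (X e))" for X
    unfolding exp_sum[OF fB] by (rule prod.mono_neutral_cong_left) (use B finite_I in \<open>auto simp: f_def\<close>)
  then have "\<E> (\<lambda>X. exp (\<Sum>e\<in>B. a e * of_bool (X e))) = \<E> (\<lambda>X. \<Prod>e\<in>I. f e (X e))" by simp
  also have "\<dots> = (\<Prod>e\<in>I. measure_pmf.expectation (bernoulli_pmf (q e)) (f e))"
    unfolding P_def using finite_I
    by (intro expectation_prod_Pi_pmf integrable_measure_pmf_finite) (auto simp: f_def)
  also have "\<dots> = (\<Prod>e\<in>B. 1 + q e * (exp (a e) - 1))"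
  proof (rule prod.mono_neutral_cong_right[OF finite_I B])
    fix e assume "e \<in> B"
    then have "0 \<le> q e" "q e \<le> 1" using q[of e] B p1 by auto
    then show "measure_pmf.expectation (bernoulli_pmf (q e)) (f e) = 1 + q e * (exp (a e) - 1)"
      using \<open>e \<in> B\<close> by (simp add: f_def algebra_simps)
  next
    have "f e = (\<lambda>_. 1)" if "e \<in> I - B" for e using that by (auto simp: f_def)
    then show "\<forall>e\<in>I - B. measure_pmf.expectation (bernoulli_pmf (q e)) (f e) = 1" by simp
  qed
  finally show ?thesis .
qed

lemma prod_le_exp:
  assumes B: "B \<subseteq> I" and a: "a \<ge> 0" and m: "real (card B) \<le> m"
  shows "(\<Prod>e\<in>B. 1 + q e * (exp a - 1)) \<le> exp (p * m * (exp a - 1))"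
proof -
  have fB: "finite B" using B finite_I by (rule finite_subset)
  have "(\<Prod>e\<in>B. 1 + q e * (exp a - 1)) \<le> (\<Prod>e\<in>B. exp (p * (exp a - 1)))"
  proof (rule prod_mono)
    fix e assume "e \<in> B"
    then have "0 \<le> q e * (exp a - 1)" "q e * (exp a - 1) \<le> p * (exp a - 1)"
      using q[of e] B a by (auto intro!: mult_right_mono mult_nonneg_nonneg)
    then show "0 \<le> 1 + q e * (exp a - 1) \<and> 1 + q e * (exp a - 1) \<le> exp (p * (exp a - 1))"
      using exp_ge_add_one_self[of "p * (exp a - 1)"] by linarith
  qed
  also have "\<dots> = exp (p * real (card B) * (exp a - 1))"
    by (simp add: exp_of_nat_mult[symmetric] mult_ac)
  also have "\<dots> \<le> exp (p * m * (exp a - 1))"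
    using m a p1 by (simp add: mult_left_mono mult_right_mono)
  finally show ?thesis .
qed

lemma prod_ge_1:
  assumes B: "B \<subseteq> I" and a: "a \<ge> 0"
  shows "(\<Prod>e\<in>B. 1 + q e * (exp a - 1)) \<ge> 1"
proof (rule Groups_Big.prod_ge_1)
  fix e assume "e \<in> B"
  then show "1 \<le> 1 + q e * (exp a - 1)" using q[of e] B a by auto
qed

text \<open>
  The Chernoff bound \<open>exp (d (exp t - 1) - t d\<^sup>2)\<close> at its minimum \<open>t = ln d\<close>.
\<close>
lemma prob_large_degree:
  assumes d1: "d \<ge> 1"
  shows "measure_pmf.prob P {X. d\<^sup>2 < real (card (edges X `` {v}))} \<le> exp (d\<^sup>2 - d\<^sup>2 * ln d)"
proof -
  have "measure_pmf.prob P {X. d\<^sup>2 < real (card (edges X `` {v}))}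
      \<le> \<E> (\<lambda>X. exp (- (d\<^sup>2 * ln d)) * exp (\<Sum>e\<in>row v. ln d * of_bool (X e)))"
  proof (rule prob_le_expectation[OF finite_set_P])
    fix X assume "d\<^sup>2 < real (card (edges X `` {v}))"
    then have "d\<^sup>2 * ln d \<le> (\<Sum>e\<in>row v. of_bool (X e)) * ln d"
      using d1 by (intro mult_right_mono) (auto simp: card_edges_Image)
    then show "1 \<le> exp (- (d\<^sup>2 * ln d)) * exp (\<Sum>e\<in>row v. ln d * of_bool (X e))"
      by (simp add: exp_add[symmetric] sum_distrib_left[symmetric] mult.commute[of _ "ln d"])
  qed simp
  also have "\<dots> = exp (- (d\<^sup>2 * ln d)) * (\<Prod>e\<in>row v. 1 + q e * (exp (ln d) - 1))"
    by (simp add: mgf[OF row_subset])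
  also have "\<dots> \<le> exp (- (d\<^sup>2 * ln d)) * exp (p * real n * (exp (ln d) - 1))"
    using d1 card_row_le_n by (intro mult_left_mono prod_le_exp row_subset) auto
  also have "\<dots> = exp (d * (d - 1) - d\<^sup>2 * ln d)"
    using d1 by (simp add: exp_add[symmetric] d_def mult_ac)
  also have "\<dots> \<le> exp (d\<^sup>2 - d\<^sup>2 * ln d)"
    using d1 by (simp add: power2_eq_square algebra_simps)
  finally show ?thesis .
qed

section \<open>Overlaps of heavy rows\<close>

text \<open>
  The excess over 1 of the moment generating function of the overlap between a set of at
  most \<open>m\<close> columns and a single row, counted only if the row is heavy. The first factor is the price
  of being heavy, the second that of meeting the set.
\<close>
definition \<eta> :: "real \<Rightarrow> real \<Rightarrow> real" where
  "\<eta> \<theta> m = exp (- 8 * d) * (exp (p * m * exp (1 + \<theta>)) - 1)"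

text \<open>
  Bound the indicator of a heavy row with \<open>r\<close> ones by \<open>exp (r - 10 d)\<close>, and let \<open>s\<close> be its
  overlap with \<open>S\<close>. It remains to compare the expectations of \<open>exp (r + \<theta> s)\<close> and \<open>exp r\<close>. Both
  are products over the entries of the row that differ only in the factors belonging to
  \<open>S\<close>, so the common factor \<open>A\<close> of the entries outside \<open>S\<close>, at most \<open>exp (2 d)\<close>, splits off.
\<close>
lemma expectation_heavy_overlap:
  assumes S: "finite S" "real (card S) \<le> m" and \<theta>: "\<theta> \<ge> 0"
  shows "\<E> (\<lambda>X. exp (if w \<in> heavy d (edges X) then \<theta> * real (card (S \<inter> edges X `` {w})) else 0))
    \<le> 1 + \<eta> \<theta> m"
proof -
  define T where "T = {e \<in> row w. snd (\<phi> e) \<in> S}"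
  define N where "N = row w - T"
  have TI: "T \<subseteq> I" and NI: "N \<subseteq> I" and RI: "row w \<subseteq> I" using row_subset by (auto simp: T_def N_def)
  have RTN: "row w = N \<union> T" "N \<inter> T = {}" by (auto simp: N_def T_def)
  have fin: "finite N" "finite T" using finite_subset[OF NI finite_I] finite_subset[OF TI finite_I] .
  define A where "A = (\<Prod>e\<in>N. 1 + q e * (exp 1 - 1))"
  define B1 where "B1 = (\<Prod>e\<in>T. 1 + q e * (exp (1 + \<theta>) - 1))"
  define B0 where "B0 = (\<Prod>e\<in>T. 1 + q e * (exp 1 - 1))"
  define a where "a e = 1 + \<theta> * of_bool (snd (\<phi> e) \<in> S)" for e
  let ?r = "\<lambda>X. (\<Sum>e\<in>row w. 1 * of_bool (X e)) :: real"
  let ?s = "\<lambda>X. (\<Sum>e\<in>row w. a e * of_bool (X e)) :: real"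
  have s: "?s X = ?r X + \<theta> * real (card (S \<inter> edges X `` {w}))" for X
    unfolding Int_commute[of S] card_edges_Image_Int sum_distrib_left sum.distrib[symmetric]
    by (intro sum.cong) (auto simp: a_def)
  have r: "?r X = real (card (edges X `` {w}))" for X by (simp add: card_edges_Image)
  have "\<E> (\<lambda>X. exp (if w \<in> heavy d (edges X) then \<theta> * real (card (S \<inter> edges X `` {w})) else 0))
     \<le> \<E> (\<lambda>X. 1 + exp (- 10 * d) * (exp (?s X) - exp (?r X)))"
  proof (rule integral_mono)
    fix X
    let ?t = "\<theta> * real (card (S \<inter> edges X `` {w}))"
    have t: "exp ?t \<ge> 1" using \<theta> by simp
    have e: "exp (- 10 * d) * (exp (?s X) - exp (?r X)) = exp (?r X - 10 * d) * (exp ?t - 1)"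
      by (simp add: s exp_add exp_diff exp_minus field_simps)
    show "exp (if w \<in> heavy d (edges X) then ?t else 0) \<le> 1 + exp (- 10 * d) * (exp (?s X) - exp (?r X))"
    proof (cases "w \<in> heavy d (edges X)")
      case True
      then have "exp (?r X - 10 * d) \<ge> 1" unfolding r by (simp add: heavy_def)
      then have "1 * (exp ?t - 1) \<le> exp (?r X - 10 * d) * (exp ?t - 1)"
        using t by (intro mult_right_mono) auto
      then show ?thesis unfolding e using True by simp
    qed (use t e in simp)
  qed auto
  also have "\<dots> = 1 + exp (- 10 * d) * (\<E> (\<lambda>X. exp (?s X)) - \<E> (\<lambda>X. exp (?r X)))"
    by simp
  also have "\<E> (\<lambda>X. exp (?r X)) = (\<Prod>e\<in>row w. 1 + q e * (exp 1 - 1))"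
    by (rule mgf[OF RI])
  also have "\<dots> = A * B0" unfolding RTN A_def B0_def by (rule prod.union_disjoint) (use fin RTN in auto)
  also have "\<E> (\<lambda>X. exp (?s X)) = (\<Prod>e\<in>row w. 1 + q e * (exp (a e) - 1))"
    by (rule mgf[OF RI])
  also have "\<dots> = (\<Prod>e\<in>N. 1 + q e * (exp (a e) - 1)) * (\<Prod>e\<in>T. 1 + q e * (exp (a e) - 1))"
    unfolding RTN(1) by (rule prod.union_disjoint) (use fin RTN in auto)
  also have "(\<Prod>e\<in>N. 1 + q e * (exp (a e) - 1)) = A"
    unfolding A_def by (intro prod.cong) (auto simp: a_def N_def T_def)
  also have "(\<Prod>e\<in>T. 1 + q e * (exp (a e) - 1)) = B1"
    unfolding B1_def by (intro prod.cong) (auto simp: a_def T_def)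
  also have "1 + exp (- 10 * d) * (A * B1 - A * B0) \<le> 1 + \<eta> \<theta> m"
  proof -
    have "card N \<le> card (row w)" unfolding N_def by (intro card_mono finite_row) auto
    then have "card N \<le> n" using card_row_le_n le_trans by blast
    then have "A \<le> exp (p * real n * (exp 1 - 1))"
      unfolding A_def by (intro prod_le_exp NI) auto
    also have "\<dots> \<le> exp (p * real n * 2)"
      using exp_le p1 by (simp add: mult_left_mono)
    finally have A: "A \<le> exp (2 * d)" by (simp add: d_def mult_ac)
    have "card T \<le> card S" unfolding T_def by (rule card_row_le[OF S(1)])
    then have "B1 \<le> exp (p * m * (exp (1 + \<theta>) - 1))"
      unfolding B1_def using S \<theta> by (intro prod_le_exp TI) auto
    also have "\<dots> \<le> exp (p * m * exp (1 + \<theta>))"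
      using p1 S by (simp add: mult_left_mono)
    finally have B1: "B1 \<le> exp (p * m * exp (1 + \<theta>))" .
    have B0: "B0 \<ge> 1" unfolding B0_def by (intro prod_ge_1 TI) auto
    have m0: "p * m * exp (1 + \<theta>) \<ge> 0" using p1 S by simp
    have A0: "A \<ge> 0" using prod_ge_1[OF NI, of 1] by (simp add: A_def)
    have "A * B1 - A * B0 = A * (B1 - B0)" by (simp add: algebra_simps)
    also have "\<dots> \<le> A * (exp (p * m * exp (1 + \<theta>)) - 1)"
      using A0 B1 B0 by (intro mult_left_mono) auto
    also have "\<dots> \<le> exp (2 * d) * (exp (p * m * exp (1 + \<theta>)) - 1)"
      using A m0 by (intro mult_right_mono) auto
    finally have "exp (- 10 * d) * (A * B1 - A * B0)
        \<le> exp (- 10 * d) * (exp (2 * d) * (exp (p * m * exp (1 + \<theta>)) - 1))"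
      by (intro mult_left_mono) auto
    also have "\<dots> = \<eta> \<theta> m" by (simp add: \<eta>_def mult.assoc[symmetric] exp_add[symmetric])
    finally show ?thesis by simp
  qed
  finally show ?thesis .
qed

text \<open>
  The event that row \<open>v\<close> equals \<open>S\<close> depends on row \<open>v\<close> alone and the overlaps of the other rows with
  the fixed set \<open>S\<close> do not depend on row \<open>v\<close>. So the exponential moment of the total
  overlap, on this event, is a product over the rows, with the indicator of the event as the factor of
  row \<open>v\<close>. This replaces conditioning on row \<open>v\<close>.
\<close>
lemma prob_row_and_overlap:
  assumes v: "v < n" and S: "finite S" "real (card S) \<le> m" and \<theta>: "\<theta> \<ge> 0"
  shows "measure_pmf.prob P {X. edges X `` {v} = S \<and>
      d\<^sup>2 < (\<Sum>w\<in>{..<n} \<inter> heavy d (edges X) - {v}. real (card (S \<inter> edges X `` {w})))}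
    \<le> measure_pmf.prob P {X. edges X `` {v} = S} * exp (real n * \<eta> \<theta> m - \<theta> * d\<^sup>2)"
proof -
  define h where "h w X = (if w \<in> heavy d (edges X) then \<theta> * real (card (S \<inter> edges X `` {w})) else 0)" for w X
  define g where "g w X = (if w = v then of_bool (edges X `` {v} = S) else exp (h w X))" for w X
  have \<eta>0: "\<eta> \<theta> m \<ge> 0" unfolding \<eta>_def using S p1 by simp
  have split: "(\<Prod>w<n. g w X) = of_bool (edges X `` {v} = S) *
     exp (\<theta> * (\<Sum>w\<in>{..<n} \<inter> heavy d (edges X) - {v}. real (card (S \<inter> edges X `` {w}))))" for X
  proof -
    have "(\<Prod>w<n. g w X) = g v X * (\<Prod>w\<in>{..<n} - {v}. g w X)"
      using v by (simp add: prod.remove)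
    also have "(\<Prod>w\<in>{..<n} - {v}. g w X) = exp (\<Sum>w\<in>{..<n} - {v}. h w X)"
      by (subst exp_sum) (auto simp: g_def intro!: prod.cong)
    also have "(\<Sum>w\<in>{..<n} - {v}. h w X)
       = (\<Sum>w\<in>{..<n} \<inter> heavy d (edges X) - {v}. \<theta> * real (card (S \<inter> edges X `` {w})))"
      by (rule sum.mono_neutral_cong_right) (auto simp: h_def)
    finally show ?thesis by (simp add: g_def sum_distrib_left)
  qed
  have "measure_pmf.prob P {X. edges X `` {v} = S \<and>
      d\<^sup>2 < (\<Sum>w\<in>{..<n} \<inter> heavy d (edges X) - {v}. real (card (S \<inter> edges X `` {w})))}
    \<le> \<E> (\<lambda>X. exp (- \<theta> * d\<^sup>2) * (\<Prod>w<n. g w X))"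
  proof (rule prob_le_expectation[OF finite_set_P])
    show "0 \<le> exp (- \<theta> * d\<^sup>2) * (\<Prod>w<n. g w X)" for X unfolding split by simp
    fix X assume X: "edges X `` {v} = S \<and>
      d\<^sup>2 < (\<Sum>w\<in>{..<n} \<inter> heavy d (edges X) - {v}. real (card (S \<inter> edges X `` {w})))"
    then have "\<theta> * d\<^sup>2 \<le> \<theta> * (\<Sum>w\<in>{..<n} \<inter> heavy d (edges X) - {v}. real (card (S \<inter> edges X `` {w})))"
      using \<theta> by (intro mult_left_mono) auto
    then show "1 \<le> exp (- \<theta> * d\<^sup>2) * (\<Prod>w<n. g w X)"
      unfolding split using X by (simp add: exp_add[symmetric])
  qed
  also have "\<dots> = exp (- \<theta> * d\<^sup>2) * \<E> (\<lambda>X. \<Prod>w<n. g w X)" by simp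
  also have "\<E> (\<lambda>X. \<Prod>w<n. g w X) = (\<Prod>w<n. \<E> (g w))"
    unfolding P_def
  proof (rule expectation_prod_blocks[OF finite_I, where K = row])
    show "disjoint_family_on row {..<n}" by (auto simp: disjoint_family_on_def row_def)
    fix w and X Y :: "'e \<Rightarrow> bool" assume "\<And>e. e \<in> row w \<Longrightarrow> X e = Y e"
    then have "edges X `` {w} = edges Y `` {w}" by (rule edges_Image_cong)
    then show "g w X = g w Y" by (cases "w = v") (auto simp: g_def h_def heavy_def)
  qed (auto simp: row_subset)
  also have "\<dots> = \<E> (g v) * (\<Prod>w\<in>{..<n} - {v}. \<E> (g w))"
    using v by (simp add: prod.remove)
  also have "\<E> (g v) = \<E> (indicator {X. edges X `` {v} = S})"
    by (intro Bochner_Integration.integral_cong) (auto simp: g_def)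
  also have "\<dots> = measure_pmf.prob P {X. edges X `` {v} = S}" by simp
  also have "(\<Prod>w\<in>{..<n} - {v}. \<E> (g w)) \<le> (\<Prod>w\<in>{..<n} - {v}. exp (\<eta> \<theta> m))"
  proof (rule prod_mono)
    fix w assume "w \<in> {..<n} - {v}"
    then have gw: "g w = (\<lambda>X. exp (h w X))" by (auto simp: g_def)
    have "\<E> (g w) \<le> 1 + \<eta> \<theta> m"
      unfolding gw h_def by (rule expectation_heavy_overlap[OF S \<theta>])
    also have "\<dots> \<le> exp (\<eta> \<theta> m)" by (rule exp_ge_add_one_self)
    finally show "0 \<le> \<E> (g w) \<and> \<E> (g w) \<le> exp (\<eta> \<theta> m)"
      by (auto simp: gw intro!: integral_nonneg)
  qed
  also have "\<dots> = exp (\<eta> \<theta> m) ^ (n - 1)" using v by simp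
  also have "\<dots> = exp (real (n - 1) * \<eta> \<theta> m)" by (rule exp_of_nat_mult[symmetric])
  also have "\<dots> \<le> exp (real n * \<eta> \<theta> m)"
    using \<eta>0 by (simp add: mult_right_mono)
  also have "exp (- \<theta> * d\<^sup>2) * (measure_pmf.prob P {X. edges X `` {v} = S} * exp (real n * \<eta> \<theta> m))
     = measure_pmf.prob P {X. edges X `` {v} = S} * exp (real n * \<eta> \<theta> m - \<theta> * d\<^sup>2)"
    by (simp add: exp_diff exp_minus field_simps)
  finally show ?thesis by (simp add: mult_left_mono)
qed

text \<open>
  Sum over all possible values \<open>S\<close> of row \<open>v\<close>; their probabilities add up to at most 1. Besides
  \<open>d\<^sup>2\<close>, also \<open>n\<close> bounds the size of \<open>S\<close>, which is the better bound for dense graphs.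
\<close>
lemma prob_large_overlap:
  assumes v: "v < n" and \<theta>: "\<theta> \<ge> 0"
  shows "measure_pmf.prob P {X. real (card (edges X `` {v})) \<le> d\<^sup>2 \<and>
      d\<^sup>2 < (\<Sum>w\<in>{..<n} \<inter> heavy d (edges X) - {v}. real (card (edges X `` {v} \<inter> edges X `` {w})))}
    \<le> exp (real n * \<eta> \<theta> (min (real n) (d\<^sup>2)) - \<theta> * d\<^sup>2)" (is "?prob \<le> ?bound")
proof -
  define \<S> where "\<S> = {S. S \<subseteq> {..<n} \<and> real (card S) \<le> d\<^sup>2}"
  have finS: "finite \<S>" unfolding \<S>_def by (rule finite_subset[of _ "Pow {..<n}"]) auto
  let ?Q = "\<lambda>S. {X. edges X `` {v} = S \<and>
      d\<^sup>2 < (\<Sum>w\<in>{..<n} \<inter> heavy d (edges X) - {v}. real (card (S \<inter> edges X `` {w})))}"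
  have sub: "edges X `` {v} \<subseteq> {..<n}" for X using edges_subset by auto
  have "?prob \<le> measure_pmf.prob P (\<Union>S\<in>\<S>. ?Q S)"
    by (rule measure_pmf.finite_measure_mono) (use sub in \<open>auto simp: \<S>_def\<close>)
  also have "\<dots> \<le> (\<Sum>S\<in>\<S>. measure_pmf.prob P (?Q S))"
    by (rule measure_pmf.finite_measure_subadditive_finite[OF finS]) auto
  also have "\<dots> \<le> (\<Sum>S\<in>\<S>. measure_pmf.prob P {X. edges X `` {v} = S} * ?bound)"
  proof (intro sum_mono prob_row_and_overlap v \<theta>)
    fix S assume "S \<in> \<S>"
    then have "S \<subseteq> {..<n}" "real (card S) \<le> d\<^sup>2" by (auto simp: \<S>_def)
    moreover have "card S \<le> n" using card_mono[OF _ \<open>S \<subseteq> {..<n}\<close>] by simp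
    ultimately show "finite S" "real (card S) \<le> min (real n) (d\<^sup>2)"
      by (auto intro: finite_subset)
  qed
  also have "\<dots> = measure_pmf.prob P (\<Union>S\<in>\<S>. {X. edges X `` {v} = S}) * ?bound"
    unfolding sum_distrib_right[symmetric]
    by (subst measure_pmf.finite_measure_finite_Union[OF finS]) (auto simp: disjoint_family_on_def)
  also have "\<dots> \<le> 1 * ?bound" by (intro mult_right_mono) auto
  finally show ?thesis by simp
qed

lemma prob_not_controlled:
  assumes d1: "d \<ge> 1" and \<theta>: "\<theta> \<ge> 0" and \<eta>: "real n * \<eta> \<theta> (min (real n) (d\<^sup>2)) \<le> 1"
  shows "measure_pmf.prob P {X. \<not> controlled n d (edges X)}
    \<le> real n * (exp (d\<^sup>2 - d\<^sup>2 * ln d) + exp (1 - \<theta> * d\<^sup>2))"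
proof -
  let ?A = "\<lambda>v. {X. d\<^sup>2 < real (card (edges X `` {v}))}"
  let ?B = "\<lambda>v. {X. real (card (edges X `` {v})) \<le> d\<^sup>2 \<and>
      d\<^sup>2 < (\<Sum>w\<in>{..<n} \<inter> heavy d (edges X) - {v}. real (card (edges X `` {v} \<inter> edges X `` {w})))}"
  have "measure_pmf.prob P {X. \<not> controlled n d (edges X)} \<le> measure_pmf.prob P (\<Union>v\<in>{..<n}. ?A v \<union> ?B v)"
    by (rule measure_pmf.finite_measure_mono) (auto simp: controlled_def not_le)
  also have "\<dots> \<le> (\<Sum>v<n. measure_pmf.prob P (?A v \<union> ?B v))"
    by (rule measure_pmf.finite_measure_subadditive_finite) auto
  also have "\<dots> \<le> (\<Sum>v<n. exp (d\<^sup>2 - d\<^sup>2 * ln d) + exp (1 - \<theta> * d\<^sup>2))"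
  proof (rule sum_mono)
    fix v assume "v \<in> {..<n}"
    have "measure_pmf.prob P (?A v \<union> ?B v) \<le> measure_pmf.prob P (?A v) + measure_pmf.prob P (?B v)"
      by (rule measure_Un_le) auto
    also have "\<dots> \<le> exp (d\<^sup>2 - d\<^sup>2 * ln d) + exp (real n * \<eta> \<theta> (min (real n) (d\<^sup>2)) - \<theta> * d\<^sup>2)"
      using \<open>v \<in> {..<n}\<close> by (intro add_mono prob_large_degree[OF d1] prob_large_overlap \<theta>) auto
    also have "\<dots> \<le> exp (d\<^sup>2 - d\<^sup>2 * ln d) + exp (1 - \<theta> * d\<^sup>2)" using \<eta> by simp
    finally show "measure_pmf.prob P (?A v \<union> ?B v) \<le> exp (d\<^sup>2 - d\<^sup>2 * ln d) + exp (1 - \<theta> * d\<^sup>2)" .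
  qed
  also have "\<dots> = real n * (exp (d\<^sup>2 - d\<^sup>2 * ln d) + exp (1 - \<theta> * d\<^sup>2))" by simp
  finally show ?thesis .
qed

lemma expectation_edge: "e \<in> I \<Longrightarrow> \<E> (\<lambda>X. of_bool (X e)) = q e"
proof -
  assume e: "e \<in> I"
  have "\<E> (\<lambda>X. of_bool (X e) :: real) = measure_pmf.expectation (map_pmf (\<lambda>X. X e) P) of_bool" by simp
  also have "map_pmf (\<lambda>X. X e) P = bernoulli_pmf (q e)"
    using e finite_I by (simp add: P_def Pi_pmf_component)
  also have "measure_pmf.expectation (bernoulli_pmf (q e)) of_bool = q e"
    using q[OF e] p1 by simp
  finally show ?thesis .
qed

lemma expected_number_of_edges: "\<E> (\<lambda>X. real (card (edges X))) \<le> p * (real n)\<^sup>2"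
proof -
  have card: "real (card (edges X)) = (\<Sum>e\<in>I. of_bool (X e))" for X
  proof -
    have "card (edges X) = card {e \<in> I. X e}"
      unfolding edges_def by (rule card_image[OF inj_on_subset[OF inj]]) auto
    then have "real (card (edges X)) = (\<Sum>e\<in>{e \<in> I. X e}. 1)" by simp
    also have "\<dots> = (\<Sum>e\<in>I. if X e then 1 else 0)" using finite_I by (rule sum.inter_filter)
    finally show ?thesis by (simp add: of_bool_def)
  qed
  have "\<E> (\<lambda>X. real (card (edges X))) = (\<Sum>e\<in>I. q e)"
    unfolding card by (simp add: Bochner_Integration.integral_sum expectation_edge)
  also have "\<dots> \<le> (\<Sum>e\<in>I. p)" using q by (intro sum_mono) auto
  also have "\<dots> = p * real (card I)" by simp
  also have "card I \<le> card ({..<n} \<times> {..<n})" by (rule card_inj_on_le[OF inj range]) simp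
  then have "p * real (card I) \<le> p * (real n)\<^sup>2"
    using p1 by (intro mult_left_mono) (auto simp: power2_eq_square simp flip: of_nat_mult)
  finally show ?thesis .
qed

end

section \<open>Tail estimates above the degree threshold\<close>

definition degree_threshold :: "nat \<Rightarrow> real" where
  "degree_threshold n = sqrt (ln (real n) / ln (ln (real n)))"

lemma degree_threshold_at_top: "filterlim degree_threshold at_top sequentially"
  unfolding degree_threshold_def by real_asymp

text \<open>
  The numerical conditions on the number of vertices under which the tail estimates below are
  explicit; each of them holds from some point on.
\<close>
definition large_enough :: "nat \<Rightarrow> bool" where
  "large_enough n \<longleftrightarrow> ln (ln (real n)) \<ge> 1 \<and> ln (real n) \<ge> 6 \<and> 3 * ln (real n) ^ 4 \<le> real n \<and>
     ln (ln (real n)) \<le> 4 * degree_threshold n \<and> 4 * degree_threshold n \<le> real n"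

lemma exp_minus_one_le: "exp z - 1 \<le> 2 * z" if "0 \<le> z" "z \<le> (1::real)"
proof -
  have "exp z \<le> 1 + z + z\<^sup>2" using that by (rule exp_bound)
  moreover have "z\<^sup>2 \<le> z" using that by (simp add: power2_eq_square mult_left_le)
  ultimately show ?thesis by simp
qed

text \<open>
  The point where the threshold enters: if \<open>d\<^sup>2 \<ge> 16 L / ln L\<close> with \<open>L = ln n\<close>, then \<open>ln d\<close> is at
  least of order \<open>ln L\<close>, which cancels the denominator, and the probability of a row with more than
  \<open>d\<^sup>2\<close> ones is at most \<open>n\<^sup>-\<^sup>2\<close>.
\<close>
lemma square_ln_bound:
  fixes d L :: real
  assumes L: "L > 1" and l: "ln L \<ge> 1" and d: "d > 0" "16 * L / ln L \<le> d\<^sup>2"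
  shows "d\<^sup>2 - d\<^sup>2 * ln d \<le> - 2 * L"
proof -
  have e2: "exp 2 \<le> (16 :: real)"
  proof -
    have "exp 2 = (exp (1::real))\<^sup>2" by (simp flip: exp_double)
    also have "\<dots> \<le> 3\<^sup>2" using exp_le by (intro power_mono) auto
    finally show ?thesis by simp
  qed
  then have ln16: "2 \<le> ln (16::real)" by (simp add: ln_ge_iff)
  have "ln (ln L / 2) \<le> ln L / 2 - 1" using l by (intro ln_le_minus_one) simp
  then have lnl: "ln (ln L) \<le> ln L / 2" using l ln2_le_25_over_36 by (simp add: ln_div)
  have "2 + ln L / 2 \<le> ln 16 + ln L - ln (ln L)" using ln16 lnl by simp
  also have "\<dots> = ln (16 * L / ln L)" using L l by (simp add: ln_div ln_mult)
  also have "\<dots> \<le> ln (d\<^sup>2)" using L l d by simp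
  also have "\<dots> = 2 * ln d" using d by (simp add: ln_realpow)
  finally have lnd: "ln L / 4 \<le> ln d - 1" by simp
  have "2 * L \<le> 16 * L / ln L * (ln L / 4)" using L l by simp
  also have "\<dots> \<le> d\<^sup>2 * (ln d - 1)"
    using d lnd l L by (intro mult_mono) auto
  finally show ?thesis by (simp add: algebra_simps)
qed

text \<open>
  The bound on \<open>n \<eta>\<close> for \<open>d \<le> ln n\<close> (with \<open>N = n\<close>, \<open>L = ln n\<close>). A row meets a given set of
  \<open>d\<^sup>2\<close> columns with probability of order \<open>d\<^sup>3 / n\<close>, which cancels the factor \<open>n\<close>; the remaining powers of \<open>d\<close> and
  \<open>exp \<theta> \<le> exp d\<close> are absorbed by \<open>exp (- 8 d)\<close>.
\<close>
lemma sparse_regime_bound: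
  fixes d L N \<theta> :: real
  assumes d: "1 \<le> d" "d \<le> L" and \<theta>: "0 \<le> \<theta>" "\<theta> \<le> ln L" "\<theta> \<le> d" and N: "3 * L ^ 4 \<le> N"
  shows "N * (exp (- 8 * d) * (exp (d / N * d\<^sup>2 * exp (1 + \<theta>)) - 1)) \<le> 1"
proof -
  have L: "L \<ge> 1" using d by simp
  then have "L ^ 4 \<ge> 1" by simp
  then have N0: "N > 0" using N by linarith
  define z where "z = d / N * d\<^sup>2 * exp (1 + \<theta>)"
  have z0: "z \<ge> 0" using d N0 by (simp add: z_def)
  have "exp \<theta> \<le> exp (ln L)" using \<theta> by simp
  then have e: "exp (1 + \<theta>) \<le> 3 * L"
    using exp_le L by (auto simp: exp_add intro!: mult_mono)
  have "z = d ^ 3 * exp (1 + \<theta>) / N" by (simp add: z_def power2_eq_square power3_eq_cube)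
  also have "\<dots> \<le> L ^ 3 * (3 * L) / N"
    using d e N0 by (intro divide_right_mono mult_mono power_mono) auto
  also have "\<dots> = 3 * L ^ 4 / N" by (simp add: power_numeral_reduce)
  also have "\<dots> \<le> 1" using N N0 by simp
  finally have z1: "z \<le> 1" .
  have d3: "d ^ 3 \<le> exp (3 * d)"
  proof -
    have "d \<le> exp d" using exp_ge_add_one_self[of d] by linarith
    then have "d ^ 3 \<le> exp d ^ 3" using d by (intro power_mono) auto
    then show ?thesis by (simp flip: exp_of_nat_mult)
  qed
  have "N * (exp (- 8 * d) * (exp z - 1)) \<le> N * (exp (- 8 * d) * (2 * z))"
    using exp_minus_one_le[OF z0 z1] N0 by (intro mult_left_mono) auto
  also have "\<dots> = exp (- 8 * d) * 2 * d ^ 3 * exp (1 + \<theta>)"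
    using N0 by (simp add: z_def power2_eq_square power3_eq_cube)
  also have "\<dots> \<le> exp (- 8 * d) * exp 1 * exp (3 * d) * exp (1 + d)"
    using d3 \<theta> exp_ge_add_one_self[of 1] d by (intro mult_mono) auto
  also have "\<dots> = exp (2 - 4 * d)" by (simp flip: exp_add)
  also have "\<dots> \<le> 1" using d by simp
  finally show ?thesis by (simp add: z_def)
qed

text \<open>
  The bound on \<open>n \<eta>\<close> for \<open>d \<ge> ln n\<close>. Here \<open>\<theta>\<close> is small and being heavy is so unlikely that the
  factor \<open>n = exp L\<close> is absorbed by \<open>exp (- 2 d)\<close>.
\<close>
lemma dense_regime_bound:
  fixes d \<theta> L :: real
  assumes L: "0 \<le> L" "L \<le> d" and \<theta>: "\<theta> \<le> 1 / 2"
  shows "exp L * (exp (- 8 * d) * (exp (d * exp (1 + \<theta>)) - 1)) \<le> 1"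
proof -
  have "exp (1 + \<theta>) \<le> 3 * 2"
    unfolding exp_add
  proof (intro mult_mono exp_le)
    show "exp \<theta> \<le> 2" using \<theta> exp_half_le2 by (meson exp_le_cancel_iff order_trans)
  qed auto
  then have "d * exp (1 + \<theta>) \<le> d * 6" using L by (intro mult_left_mono) auto
  then have "exp L * (exp (- 8 * d) * (exp (d * exp (1 + \<theta>)) - 1)) \<le> exp L * (exp (- 8 * d) * exp (d * 6))"
    by (intro mult_left_mono) (auto intro: order_trans[of _ "exp (d * exp (1 + \<theta>))"])
  also have "\<dots> = exp (L - 2 * d)" by (simp flip: exp_add)
  also have "\<dots> \<le> 1" using L by simp
  finally show ?thesis .
qed

context random_bipartite
begin

lemma prob_not_controlled_le:
  assumes big: "large_enough n"
    and d: "4 * degree_threshold n \<le> d"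
  shows "measure_pmf.prob P {X. \<not> controlled n d (edges X)} \<le> 2 / real n"
proof -
  have n: "ln (ln (real n)) \<ge> 1" "ln (real n) \<ge> 6" "3 * ln (real n) ^ 4 \<le> real n"
      "ln (ln (real n)) \<le> 4 * degree_threshold n"
    using big by (simp_all add: large_enough_def)
  define L where "L = ln (real n)"
  have n0: "real n > 0" using n(2) by (cases "n = 0") auto
  have nL: "real n = exp L" using n0 by (simp add: L_def)
  have L: "L \<ge> 6" "ln L \<ge> 1" using n by (simp_all add: L_def)
  have d1: "d \<ge> 1" using n d by linarith
  have "(4 * degree_threshold n)\<^sup>2 \<le> d\<^sup>2"
    using d n by (intro power_mono) auto
  then have d2: "16 * L / ln L \<le> d\<^sup>2"
    using L by (simp add: degree_threshold_def power_mult_distrib L_def)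
  \<comment> \<open>chosen so that \<open>exp (- \<theta> * d\<^sup>2)\<close> is \<open>n\<^sup>-\<^sup>3\<close>, leaving room for a union bound over \<open>n\<close> rows\<close>
  define \<theta> where "\<theta> = 3 * L / d\<^sup>2"
  have \<theta>0: "\<theta> \<ge> 0" using L by (simp add: \<theta>_def)
  have \<theta>d: "\<theta> * d\<^sup>2 = 3 * L" using d1 by (simp add: \<theta>_def)
  have pd: "d / real n = p" using n0 by (simp add: d_def)
  have "real n * \<eta> \<theta> (min (real n) (d\<^sup>2)) \<le> 1"
  proof (cases "d \<le> L")
    case True
    have "3 * L \<le> ln L * (16 * L / ln L)" using L by simp
    also have "\<dots> \<le> ln L * d\<^sup>2" using d2 L by (intro mult_left_mono) auto
    finally have \<theta>L: "\<theta> \<le> ln L" using d1 by (simp add: \<theta>_def divide_le_eq)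
    then have "\<theta> \<le> d" using n d by (simp add: L_def)
    have "p * min (real n) (d\<^sup>2) * exp (1 + \<theta>) \<le> p * d\<^sup>2 * exp (1 + \<theta>)"
      using p1 by (intro mult_left_mono mult_right_mono) auto
    then have "real n * \<eta> \<theta> (min (real n) (d\<^sup>2)) \<le> real n * (exp (- 8 * d) * (exp (p * d\<^sup>2 * exp (1 + \<theta>)) - 1))"
      unfolding \<eta>_def by (intro mult_left_mono) auto
    also have "\<dots> \<le> 1"
      by (rule sparse_regime_bound[OF d1 True \<theta>0 \<theta>L \<open>\<theta> \<le> d\<close>, of "real n", unfolded pd])
         (use n in \<open>simp add: L_def\<close>)
    finally show ?thesis .
  next
    case False
    have "6 * L \<le> L * L" using L by (intro mult_right_mono) auto
    also have "L * L \<le> d\<^sup>2" unfolding power2_eq_square using False L by (intro mult_mono) auto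
    finally have \<theta>12: "\<theta> \<le> 1 / 2" using d1 by (simp add: \<theta>_def divide_le_eq)
    have "p * min (real n) (d\<^sup>2) \<le> d"
      unfolding d_def using p1 by (simp add: mult.commute[of "real n"] mult_left_mono)
    then have "p * min (real n) (d\<^sup>2) * exp (1 + \<theta>) \<le> d * exp (1 + \<theta>)"
      by (intro mult_right_mono) auto
    then have "real n * \<eta> \<theta> (min (real n) (d\<^sup>2)) \<le> exp L * (exp (- 8 * d) * (exp (d * exp (1 + \<theta>)) - 1))"
      unfolding \<eta>_def nL[symmetric] by (intro mult_left_mono) auto
    also have "\<dots> \<le> 1" using False L \<theta>12 by (intro dense_regime_bound) auto
    finally show ?thesis .
  qed
  then have "measure_pmf.prob P {X. \<not> controlled n d (edges X)}
    \<le> real n * (exp (d\<^sup>2 - d\<^sup>2 * ln d) + exp (1 - \<theta> * d\<^sup>2))"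
    by (rule prob_not_controlled[OF d1 \<theta>0])
  also have "\<dots> \<le> exp L * (exp (- 2 * L) + exp (- 2 * L))"
  proof -
    have "d\<^sup>2 - d\<^sup>2 * ln d \<le> - 2 * L" using L d1 d2 by (intro square_ln_bound) auto
    then show ?thesis unfolding nL \<theta>d using L by (intro mult_left_mono add_mono) auto
  qed
  also have "\<dots> = 2 * exp (- L)" by (simp flip: exp_add)
  also have "\<dots> = 2 / real n" by (simp add: nL exp_minus divide_inverse)
  finally show ?thesis .
qed

end

section \<open>Random graphs\<close>

text \<open>
  Orienting each edge towards its larger end turns the random graph into a strictly
  upper triangular random matrix with independent entries. Its rows and its columns are
  controlled simultaneously outside an event of probability \<open>4 / n\<close>. The bounds do not depend on \<open>q\<close>, which is what
  allows random edge probabilities.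
\<close>
lemma bernoulli_graph_op_norm_and_trace:
  fixes q :: "nat \<Rightarrow> nat \<Rightarrow> real"
  assumes big: "large_enough n"
    and p: "p \<le> 1" "4 * degree_threshold n \<le> real n * p"
    and q: "\<And>i j. i < j \<Longrightarrow> j < n \<Longrightarrow> 0 \<le> q i j \<and> q i j \<le> p"
    and c: "0 \<le> c" "c * (real n * p) \<le> \<beta>"
  shows "measure_pmf.prob (bernoulli_graph n q) {E. \<not> \<bar>op_norm (scaled_adjacency n c E)\<bar> \<le> 26 * \<beta>} \<le> 4 / real n"
    and "\<epsilon> > 0 \<Longrightarrow> measure_pmf.prob (bernoulli_graph n q)
      {E. \<not> \<bar>trace_mat (scaled_adjacency n c E ^\<^sub>m 2)\<bar> \<le> \<epsilon> * \<bar>real n\<bar>} \<le> 2 * \<beta>\<^sup>2 / (\<epsilon> * (4 * degree_threshold n))"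
proof -
  have n: "ln (ln (real n)) \<ge> 1" "ln (real n) \<ge> 6" "3 * ln (real n) ^ 4 \<le> real n"
      "ln (ln (real n)) \<le> 4 * degree_threshold n"
    using big by (simp_all add: large_enough_def)
  define I :: "(nat \<times> nat) set" where "I = {(i, j). i < j \<and> j < n}"
  have I: "I \<subseteq> {..<n} \<times> {..<n}" by (auto simp: I_def)
  then have fI: "finite I" by (rule finite_subset) auto
  have n0: "real n > 0" using n(2) by (cases "n = 0") auto
  have np: "real n * p > 0" using n p by linarith
  then have p0: "p > 0" using n0 by (simp add: zero_less_mult_iff)
  have T0: "degree_threshold n > 0" using n by linarith
  interpret R: random_bipartite I id "\<lambda>(i, j). q i j" n p
    by unfold_locales (use fI I p p0 q in \<open>auto simp: I_def\<close>)
  interpret C: random_bipartite I prod.swap "\<lambda>(i, j). q i j" n p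
    by unfold_locales (use fI I p p0 q in \<open>auto simp: I_def\<close>)
  have edges: "R.edges X = {e \<in> I. X e}" "C.edges X = (R.edges X)\<inverse>" for X
    by (auto simp: R.edges_def C.edges_def image_iff)
  define g :: "(nat \<times> nat \<Rightarrow> bool) \<Rightarrow> nat set set" where "g X = {{i, j} | i j. X (i, j)}" for X
  have B: "bernoulli_graph n q = map_pmf g R.P"
    unfolding R.P_def unfolding bernoulli_graph_def I_def g_def by (simp add: case_prod_unfold)
  have supp: "g X = {{i, j} | i j. (i, j) \<in> R.edges X}" if "X \<in> set_pmf R.P" for X
  proof -
    have "X e \<Longrightarrow> e \<in> I" for e
      using set_Pi_pmf_subset[OF fI] that unfolding R.P_def by fastforce
    then show ?thesis unfolding g_def edges by blast
  qed
  have sub: "R.edges X \<subseteq> {(i, j). i < j \<and> j < n}" for X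
    unfolding edges unfolding I_def by auto
  have d: "R.d = real n * p" by (simp add: R.d_def)

  have "measure_pmf.prob (bernoulli_graph n q) {E. \<not> \<bar>op_norm (scaled_adjacency n c E)\<bar> \<le> 26 * \<beta>}
    = measure_pmf.prob R.P {X. \<not> \<bar>op_norm (scaled_adjacency n c (g X))\<bar> \<le> 26 * \<beta>}"
    by (simp add: B vimage_def)
  also have "\<dots> \<le> measure_pmf.prob R.P
      ({X. \<not> controlled n R.d (R.edges X)} \<union> {X. \<not> controlled n C.d (C.edges X)})"
  proof (rule measure_pmf.finite_measure_mono_AE)
    show "AE X in R.P. X \<in> {X. \<not> \<bar>op_norm (scaled_adjacency n c (g X))\<bar> \<le> 26 * \<beta>} \<longrightarrow>
      X \<in> {X. \<not> controlled n R.d (R.edges X)} \<union> {X. \<not> controlled n C.d (C.edges X)}"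
      unfolding AE_measure_pmf_iff
    proof safe
      fix X assume X: "X \<in> set_pmf R.P" and bad: "\<not> \<bar>op_norm (scaled_adjacency n c (g X))\<bar> \<le> 26 * \<beta>"
        and "controlled n R.d (R.edges X)" "controlled n C.d (C.edges X)"
      then have "controlled n (real n * p) (R.edges X)" "controlled n (real n * p) ((R.edges X)\<inverse>)"
        by (simp_all add: d edges(2))
      note * = op_norm_scaled_adjacency_le[OF np c(1) sub this supp[OF X]]
      have "26 * c * (real n * p) \<le> 26 * \<beta>" using c by simp
      with * bad show False by linarith
    qed
  qed auto
  also have "\<dots> \<le> measure_pmf.prob R.P {X. \<not> controlled n R.d (R.edges X)}
      + measure_pmf.prob R.P {X. \<not> controlled n C.d (C.edges X)}"
    by (rule measure_Un_le) auto
  also have "\<dots> \<le> 2 / real n + 2 / real n"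
    using R.prob_not_controlled_le[OF big] C.prob_not_controlled_le[OF big] p unfolding d by (intro add_mono)
  finally show "measure_pmf.prob (bernoulli_graph n q) {E. \<not> \<bar>op_norm (scaled_adjacency n c E)\<bar> \<le> 26 * \<beta>} \<le> 4 / real n"
    by simp

  assume \<epsilon>: "\<epsilon> > 0"
  have tr: "trace_mat (scaled_adjacency n c (g X) ^\<^sub>m 2) = 2 * c\<^sup>2 * real (card (R.edges X))"
    if X: "X \<in> set_pmf R.P" for X
  proof -
    let ?F = "R.edges X"
    have edge: "of_bool ({i, j} \<in> g X) = (of_bool ((i, j) \<in> ?F) + of_bool ((j, i) \<in> ?F) :: real)" for i j
      unfolding supp[OF X] by (rule of_bool_edge[OF sub refl])
    have F: "(\<Sum>i<n. \<Sum>j<n. of_bool ((i, j) \<in> ?F)) = real (card ?F)"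
    proof -
      have "(\<Sum>i<n. \<Sum>j<n. of_bool ((i, j) \<in> ?F)) = (\<Sum>e\<in>{..<n} \<times> {..<n}. of_bool (e \<in> ?F) :: real)"
        by (simp only: sum.cartesian_product split_def prod.collapse)
      also have "\<dots> = (\<Sum>e\<in>?F. 1)"
        by (rule sum.mono_neutral_cong_right) (use R.edges_subset in auto)
      finally show ?thesis by simp
    qed
    have "trace_mat (scaled_adjacency n c (g X) ^\<^sub>m 2)
        = (\<Sum>i<n. \<Sum>j<n. c\<^sup>2 * of_bool ((i, j) \<in> ?F) + c\<^sup>2 * of_bool ((j, i) \<in> ?F))"
      unfolding trace_mat_square[OF scaled_adjacency_carrier]
    proof (intro sum.cong refl)
      fix i j assume "i \<in> {..<n}" "j \<in> {..<n}"
      then have "scaled_adjacency n c (g X) $$ (i, j) * scaled_adjacency n c (g X) $$ (j, i)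
          = c\<^sup>2 * of_bool ({i, j} \<in> g X)"
        by (simp add: scaled_adjacency_def power2_eq_square insert_commute)
      then show "scaled_adjacency n c (g X) $$ (i, j) * scaled_adjacency n c (g X) $$ (j, i)
          = c\<^sup>2 * of_bool ((i, j) \<in> ?F) + c\<^sup>2 * of_bool ((j, i) \<in> ?F)"
        by (simp only: edge distrib_left)
    qed
    also have "\<dots> = c\<^sup>2 * (\<Sum>i<n. \<Sum>j<n. of_bool ((i, j) \<in> ?F)) + c\<^sup>2 * (\<Sum>i<n. \<Sum>j<n. of_bool ((j, i) \<in> ?F))"
      by (simp only: sum.distrib sum_distrib_left)
    also have "(\<Sum>i<n. \<Sum>j<n. of_bool ((j, i) \<in> ?F)) = (\<Sum>j<n. \<Sum>i<n. of_bool ((j, i) \<in> ?F) :: real)"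
      by (rule sum.swap)
    also have "c\<^sup>2 * (\<Sum>i<n. \<Sum>j<n. of_bool ((i, j) \<in> ?F)) + c\<^sup>2 * (\<Sum>j<n. \<Sum>i<n. of_bool ((j, i) \<in> ?F))
        = 2 * c\<^sup>2 * real (card ?F)"
      unfolding F by simp
    finally show ?thesis .
  qed
  have "measure_pmf.prob (bernoulli_graph n q)
      {E. \<not> \<bar>trace_mat (scaled_adjacency n c E ^\<^sub>m 2)\<bar> \<le> \<epsilon> * \<bar>real n\<bar>}
    = measure_pmf.prob R.P {X. \<not> \<bar>trace_mat (scaled_adjacency n c (g X) ^\<^sub>m 2)\<bar> \<le> \<epsilon> * \<bar>real n\<bar>}"
    by (simp add: B vimage_def)
  also have "\<dots> \<le> measure_pmf.prob R.P {X. \<epsilon> * real n < 2 * c\<^sup>2 * real (card (R.edges X))}"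
    by (rule measure_pmf.finite_measure_mono_AE) (auto simp: AE_measure_pmf_iff tr not_le)
  also have "\<dots> \<le> R.\<E> (\<lambda>X. 2 * c\<^sup>2 / (\<epsilon> * real n) * real (card (R.edges X)))"
    using \<epsilon> n0 by (intro prob_le_expectation R.finite_set_P) (auto simp: field_simps)
  also have "\<dots> = 2 * c\<^sup>2 / (\<epsilon> * real n) * R.\<E> (\<lambda>X. real (card (R.edges X)))" by simp
  also have "\<dots> \<le> 2 * c\<^sup>2 / (\<epsilon> * real n) * (p * (real n)\<^sup>2)"
    using \<epsilon> by (intro mult_left_mono R.expected_number_of_edges) auto
  also have "\<dots> = 2 * (c * (real n * p))\<^sup>2 / (\<epsilon> * (real n * p))"
    using n0 p0 \<epsilon> by (simp add: field_simps power2_eq_square)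
  also have "\<dots> \<le> 2 * \<beta>\<^sup>2 / (\<epsilon> * (4 * degree_threshold n))"
    using c np \<epsilon> p T0 by (intro frac_le mult_left_mono power_mono) auto
  finally show "measure_pmf.prob (bernoulli_graph n q)
      {E. \<not> \<bar>trace_mat (scaled_adjacency n c E ^\<^sub>m 2)\<bar> \<le> \<epsilon> * \<bar>real n\<bar>} \<le> 2 * \<beta>\<^sup>2 / (\<epsilon> * (4 * degree_threshold n))" .
qed

lemma eventually_large_enough: "eventually large_enough sequentially"
proof -
  have "eventually (\<lambda>n. ln (ln (real n)) \<ge> 1) sequentially" by real_asymp
  moreover have "eventually (\<lambda>n. ln (real n) \<ge> 6) sequentially" by real_asymp
  moreover have "eventually (\<lambda>n. 3 * ln (real n) ^ 4 \<le> real n) sequentially" by real_asymp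
  moreover have "eventually (\<lambda>n. ln (ln (real n)) \<le> 4 * degree_threshold n) sequentially"
    unfolding degree_threshold_def by real_asymp
  moreover have "eventually (\<lambda>n. 4 * degree_threshold n \<le> real n) sequentially"
    unfolding degree_threshold_def by real_asymp
  ultimately show ?thesis unfolding large_enough_def by eventually_elim auto
qed

lemma much_greater_threshold:
  assumes "a \<ggreater> (\<lambda>n. sqrt (ln (real n) / ln (ln (real n))))"
  shows "eventually (\<lambda>n. 4 * degree_threshold n \<le> a n) sequentially"
proof -
  have "eventually (\<lambda>n. a n / degree_threshold n \<ge> 4) sequentially"
    using assms unfolding much_greater_def degree_threshold_def filterlim_at_top by blast
  moreover have "eventually (\<lambda>n. degree_threshold n > 0) sequentially"
    using degree_threshold_at_top by (simp add: filterlim_at_top_dense)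
  ultimately show ?thesis by eventually_elim (simp add: le_divide_eq)
qed

lemma tendsto_prob_one:
  assumes M: "\<And>n. prob_space (M n)" "\<And>n. sets (M n) = UNIV"
    and le: "eventually (\<lambda>n. measure (M n) {\<omega>. \<not> Q n \<omega>} \<le> \<delta> n) sequentially"
    and \<delta>: "\<delta> \<longlonglongrightarrow> (0::real)"
  shows "(\<lambda>n. measure (M n) {\<omega> \<in> space (M n). Q n \<omega>}) \<longlonglongrightarrow> 1"
proof (rule tendsto_sandwich)
  have sp: "space (M n) = UNIV" for n using M(2)[of n] sets.top[of "M n"] sets.space_closed[of "M n"] by auto
  have eq: "measure (M n) {\<omega> \<in> space (M n). Q n \<omega>} = 1 - measure (M n) {\<omega>. \<not> Q n \<omega>}" for n
  proof -
    interpret prob_space "M n" by (rule M)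
    have "prob (space (M n) - {\<omega>. \<not> Q n \<omega>}) = 1 - prob {\<omega>. \<not> Q n \<omega>}"
      by (rule prob_compl) (simp add: M)
    also have "space (M n) - {\<omega>. \<not> Q n \<omega>} = {\<omega> \<in> space (M n). Q n \<omega>}" by (auto simp: sp)
    finally show ?thesis .
  qed
  show "eventually (\<lambda>n. 1 - \<delta> n \<le> measure (M n) {\<omega> \<in> space (M n). Q n \<omega>}) sequentially"
    using le by eventually_elim (simp add: eq)
  show "eventually (\<lambda>n. measure (M n) {\<omega> \<in> space (M n). Q n \<omega>} \<le> 1) sequentially"
    using M(1) by (simp add: prob_space.prob_le_1)
  show "(\<lambda>n. 1 - \<delta> n) \<longlonglongrightarrow> 1" using tendsto_diff[OF tendsto_const \<delta>, of 1] by simp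
qed simp

text \<open>
  The assumption \<open>mix\<close> is what remains of \<open>M n\<close> being a mixture of graphs with independent edges
  of probability at most \<open>p n\<close>: whatever bound holds for all of these holds for \<open>M n\<close>. A single graph with
  independent edges and the graphon model are both of this kind.
\<close>
lemma whp_bounds:
  fixes M :: "nat \<Rightarrow> nat set set measure" and c p :: "nat \<Rightarrow> real"
  assumes M: "\<And>n. prob_space (M n)" "\<And>n. sets (M n) = UNIV"
    and p: "eventually (\<lambda>n. p n \<le> 1 \<and> 4 * degree_threshold n \<le> real n * p n) sequentially"
    and c: "eventually (\<lambda>n. 0 \<le> c n \<and> c n * (real n * p n) \<le> \<beta>) sequentially"
    and mix: "eventually (\<lambda>n. \<forall>S \<delta>.
        (\<forall>q. (\<forall>i j. i < j \<longrightarrow> j < n \<longrightarrow> 0 \<le> q i j \<and> q i j \<le> p n) \<longrightarrow>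
              measure_pmf.prob (bernoulli_graph n q) S \<le> \<delta>) \<longrightarrow> measure (M n) S \<le> \<delta>) sequentially"
  shows "bounded_whp M (\<lambda>n E. op_norm (scaled_adjacency n (c n) E))"
    and "smallo_whp M (\<lambda>n E. trace_mat (scaled_adjacency n (c n) E ^\<^sub>m 2)) (\<lambda>n. real n)"
proof -
  show "bounded_whp M (\<lambda>n E. op_norm (scaled_adjacency n (c n) E))"
    unfolding bounded_whp_def
  proof (intro exI[of _ "26 * \<beta>"] tendsto_prob_one[OF M])
    show "eventually (\<lambda>n. measure (M n) {E. \<not> \<bar>op_norm (scaled_adjacency n (c n) E)\<bar> \<le> 26 * \<beta>} \<le> 4 / real n) sequentially"
      using eventually_large_enough p c mix
    proof eventually_elim
      case (elim n)
      show ?case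
        by (rule elim(4)[rule_format], rule bernoulli_graph_op_norm_and_trace(1))
           (use elim(1-3) in auto)
    qed
    show "(\<lambda>n. 4 / real n) \<longlonglongrightarrow> 0" by real_asymp
  qed
  show "smallo_whp M (\<lambda>n E. trace_mat (scaled_adjacency n (c n) E ^\<^sub>m 2)) (\<lambda>n. real n)"
    unfolding smallo_whp_def
  proof (intro allI impI tendsto_prob_one[OF M])
    fix \<epsilon> :: real assume "\<epsilon> > 0"
    show "eventually (\<lambda>n. measure (M n) {E. \<not> \<bar>trace_mat (scaled_adjacency n (c n) E ^\<^sub>m 2)\<bar> \<le> \<epsilon> * \<bar>real n\<bar>}
        \<le> 2 * \<beta>\<^sup>2 / (\<epsilon> * (4 * degree_threshold n))) sequentially"
      using eventually_large_enough p c mix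
    proof eventually_elim
      case (elim n)
      show ?case
        by (rule elim(4)[rule_format], rule bernoulli_graph_op_norm_and_trace(2))
           (use elim(1-3) \<open>\<epsilon> > 0\<close> in auto)
    qed
    show "(\<lambda>n. 2 * \<beta>\<^sup>2 / (\<epsilon> * (4 * degree_threshold n))) \<longlonglongrightarrow> 0"
      unfolding degree_threshold_def using \<open>\<epsilon> > 0\<close> by real_asymp
  qed
qed

text \<open>
  The law of the graph is the average, over the positions \<open>u\<close>, of the laws with independent edges given
  \<open>u\<close>, so a bound uniform in \<open>u\<close> survives.
\<close>
lemma measure_graphon_graph_le:
  assumes W: "graphon W"
    and le: "\<And>u. (\<And>i. i < n \<Longrightarrow> u i \<in> {0..1}) \<Longrightarrow>
      measure_pmf.prob (bernoulli_graph n (\<lambda>i j. \<rho> * W (u i) (u j))) S \<le> \<delta>"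
  shows "measure (graphon_graph n \<rho> W) S \<le> \<delta>"
proof -
  let ?M = "\<Pi>\<^sub>M i\<in>{..<n}. restrict_space lborel {0..1::real}"
  let ?K = "\<lambda>u. measure_pmf (bernoulli_graph n (\<lambda>i j. \<rho> * W (u i) (u j)))"
  have "prob_space (restrict_space lborel {0..1::real})"
    by (intro prob_spaceI) (simp add: space_restrict_space emeasure_restrict_space)
  then interpret U: prob_space ?M by (intro prob_space_PiM)
  interpret G: prob_space "graphon_graph n \<rho> W" by (rule prob_space_graphon_graph[OF W])
  have "0 \<le> measure_pmf.prob (bernoulli_graph n (\<lambda>i j. \<rho> * W 0 0)) S" by simp
  also have "\<dots> \<le> \<delta>" using le[of "\<lambda>_. 0"] by simp
  finally have \<delta>: "\<delta> \<ge> 0" .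
  have "emeasure (graphon_graph n \<rho> W) S = (\<integral>\<^sup>+ u. emeasure (?K u) S \<partial>?M)"
    unfolding graphon_graph_def
    by (rule emeasure_bind[OF U.not_empty graphon_kernel_measurable[OF W]]) simp
  also have "\<dots> \<le> (\<integral>\<^sup>+ u. ennreal \<delta> \<partial>?M)"
  proof (rule nn_integral_mono)
    fix u assume "u \<in> space ?M"
    then have "u i \<in> {0..1}" if "i < n" for i
      using that by (auto simp: space_PiM PiE_iff space_restrict_space)
    from le[of u, OF this] show "emeasure (?K u) S \<le> ennreal \<delta>"
      by (simp add: measure_pmf.emeasure_eq_measure ennreal_leI)
  qed
  also have "\<dots> = ennreal \<delta>" using U.emeasure_space_1 by simp
  finally show ?thesis using \<delta> by (simp add: G.emeasure_eq_measure)
qed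

lemma sets_graphon_graph:
  assumes W: "graphon W" shows "sets (graphon_graph n \<rho> W) = UNIV"
proof -
  have "prob_space (restrict_space lborel {0..1::real})"
    by (intro prob_spaceI) (simp add: space_restrict_space emeasure_restrict_space)
  then have "prob_space (\<Pi>\<^sub>M i\<in>{..<n}. restrict_space lborel {0..1::real})" by (intro prob_space_PiM)
  then show ?thesis
    unfolding graphon_graph_def
    by (subst sets_bind_measurable[OF graphon_kernel_measurable[OF W]]) (auto intro: prob_space.not_empty)
qed

lemma erdos_renyi_graphs:
  fixes \<beta> :: real
  assumes b: "\<beta> > 0" and p: "\<forall>n\<ge>1. p n \<in> {0..1}"
    and mg: "(\<lambda>n. real n * p n) \<ggreater> (\<lambda>n. sqrt (ln (real n) / ln (ln (real n))))"
  shows "bounded_whp (\<lambda>n. measure_pmf (erdos_renyi n (p n))) (\<lambda>n E. op_norm (scaled_adjacency n (\<beta> / (real n * p n)) E))"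
    and "smallo_whp (\<lambda>n. measure_pmf (erdos_renyi n (p n))) (\<lambda>n E. trace_mat (scaled_adjacency n (\<beta> / (real n * p n)) E ^\<^sub>m 2)) (\<lambda>n. real n)"
proof -
  have ps: "prob_space (measure_pmf (erdos_renyi n (p n)))" for n by (rule measure_pmf.prob_space_axioms)
  have sets: "sets (measure_pmf (erdos_renyi n (p n))) = UNIV" for n by simp
  have ev1: "eventually (\<lambda>n. p n \<le> 1 \<and> 4 * degree_threshold n \<le> real n * p n) sequentially"
    using much_greater_threshold[OF mg] eventually_ge_at_top[of 1] by eventually_elim (use p in auto)
  have ev2: "eventually (\<lambda>n. 0 \<le> \<beta> / (real n * p n) \<and> \<beta> / (real n * p n) * (real n * p n) \<le> \<beta>) sequentially"
    using eventually_ge_at_top[of 1] by eventually_elim (use p b in auto)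
  have mix: "eventually (\<lambda>n. \<forall>S \<delta>.
        (\<forall>q. (\<forall>i j. i < j \<longrightarrow> j < n \<longrightarrow> 0 \<le> q i j \<and> q i j \<le> p n) \<longrightarrow>
              measure_pmf.prob (bernoulli_graph n q) S \<le> \<delta>) \<longrightarrow> measure_pmf.prob (erdos_renyi n (p n)) S \<le> \<delta>) sequentially"
    using eventually_ge_at_top[of 1] by eventually_elim (use p in \<open>auto simp: erdos_renyi_def\<close>)
  show "bounded_whp (\<lambda>n. measure_pmf (erdos_renyi n (p n))) (\<lambda>n E. op_norm (scaled_adjacency n (\<beta> / (real n * p n)) E))"
    "smallo_whp (\<lambda>n. measure_pmf (erdos_renyi n (p n))) (\<lambda>n E. trace_mat (scaled_adjacency n (\<beta> / (real n * p n)) E ^\<^sub>m 2)) (\<lambda>n. real n)"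
    using whp_bounds[OF ps sets ev1 ev2 mix] by auto
qed

text \<open>
  The density \<open>\<rho> n\<close> may exceed 1 when \<open>W\<close> stays below 1. The edge probabilities are
  then bounded by \<open>min 1 (\<rho> n)\<close>, and \<open>n\<close> times this is still above the degree threshold because \<open>n\<close>
  itself is.
\<close>
lemma graphon_graphs:
  fixes \<beta> :: real
  assumes b: "\<beta> > 0" and W: "graphon W"
    and \<rho>: "\<forall>n\<ge>1. \<forall>x\<in>{0..1}. \<forall>y\<in>{0..1}. \<rho> n * W x y \<in> {0..1}"
    and mg: "(\<lambda>n. real n * \<rho> n) \<ggreater> (\<lambda>n. sqrt (ln (real n) / ln (ln (real n))))"
  shows "bounded_whp (\<lambda>n. graphon_graph n (\<rho> n) W) (\<lambda>n E. op_norm (scaled_adjacency n (\<beta> / (real n * \<rho> n)) E))"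
    and "smallo_whp (\<lambda>n. graphon_graph n (\<rho> n) W) (\<lambda>n E. trace_mat (scaled_adjacency n (\<beta> / (real n * \<rho> n)) E ^\<^sub>m 2)) (\<lambda>n. real n)"
proof -
  define p where "p n = min 1 (\<rho> n)" for n
  have pos: "eventually (\<lambda>n. n \<ge> 1 \<and> \<rho> n > 0 \<and> 4 * degree_threshold n \<le> real n * p n) sequentially"
    using much_greater_threshold[OF mg] eventually_large_enough eventually_ge_at_top[of 1]
  proof eventually_elim
    case (elim n)
    then have "0 < real n * \<rho> n" by (auto simp: large_enough_def)
    then show ?case using elim by (auto simp: large_enough_def zero_less_mult_iff p_def min_def)
  qed
  have ev1: "eventually (\<lambda>n. p n \<le> 1 \<and> 4 * degree_threshold n \<le> real n * p n) sequentially"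
    using pos by eventually_elim (simp add: p_def)
  have ev2: "eventually (\<lambda>n. 0 \<le> \<beta> / (real n * \<rho> n) \<and> \<beta> / (real n * \<rho> n) * (real n * p n) \<le> \<beta>) sequentially"
    using pos
  proof eventually_elim
    case (elim n)
    have "\<beta> / (real n * \<rho> n) * (real n * p n) = \<beta> * (p n / \<rho> n)" using elim by simp
    also have "\<dots> \<le> \<beta> * 1" using elim b by (intro mult_left_mono) (auto simp: p_def)
    finally show ?case using elim b by auto
  qed
  have mix: "eventually (\<lambda>n. \<forall>S \<delta>.
        (\<forall>q. (\<forall>i j. i < j \<longrightarrow> j < n \<longrightarrow> 0 \<le> q i j \<and> q i j \<le> p n) \<longrightarrow>
              measure_pmf.prob (bernoulli_graph n q) S \<le> \<delta>) \<longrightarrow> measure (graphon_graph n (\<rho> n) W) S \<le> \<delta>) sequentially"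
    using pos
  proof eventually_elim
    case (elim n)
    show ?case
    proof (intro allI impI measure_graphon_graph_le[OF W])
      fix S \<delta> u
      assume bound: "\<forall>q. (\<forall>i j. i < j \<longrightarrow> j < n \<longrightarrow> 0 \<le> q i j \<and> q i j \<le> p n) \<longrightarrow>
              measure_pmf.prob (bernoulli_graph n q) S \<le> \<delta>"
        and u: "\<And>i. i < n \<Longrightarrow> u i \<in> {0..1::real}"
      show "measure_pmf.prob (bernoulli_graph n (\<lambda>i j. \<rho> n * W (u i) (u j))) S \<le> \<delta>"
      proof (rule bound[rule_format])
        fix i j assume "i < j" "j < n"
        then have ij: "u i \<in> {0..1}" "u j \<in> {0..1}" using u by auto
        then have "W (u i) (u j) \<le> 1" using W by (simp add: graphon_def)
        then have "\<rho> n * W (u i) (u j) \<le> \<rho> n" using elim by (simp add: mult_left_le)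
        moreover have "\<rho> n * W (u i) (u j) \<in> {0..1}" using \<rho> elim ij by blast
        ultimately show "0 \<le> \<rho> n * W (u i) (u j) \<and> \<rho> n * W (u i) (u j) \<le> p n"
          by (auto simp: p_def)
      qed
    qed
  qed
  show "bounded_whp (\<lambda>n. graphon_graph n (\<rho> n) W) (\<lambda>n E. op_norm (scaled_adjacency n (\<beta> / (real n * \<rho> n)) E))"
    "smallo_whp (\<lambda>n. graphon_graph n (\<rho> n) W) (\<lambda>n E. trace_mat (scaled_adjacency n (\<beta> / (real n * \<rho> n)) E ^\<^sub>m 2)) (\<lambda>n. real n)"
    using whp_bounds[OF prob_space_graphon_graph[OF W] sets_graphon_graph[OF W] ev1 ev2 mix] by auto
qed

theorem lemma2p1:
  shows
    "(\<forall>\<beta>>0::real.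
        let A = (\<lambda>n. (\<beta> / real n) \<cdot>\<^sub>m (all_ones n * (all_ones n)\<^sup>T - 1\<^sub>m n))
        in (\<lambda>n. op_norm (A n)) \<in> O(\<lambda>_. 1) \<and>
           (\<lambda>n. trace_mat (A n ^\<^sub>m 2)) \<in> o(\<lambda>n. real n)) \<and>
     (\<forall>\<beta>>0::real. \<forall>(d :: nat \<Rightarrow> nat) (G :: nat \<Rightarrow> nat set set).
        (\<forall>n\<ge>1. regular_graph n (d n) (G n)) \<longrightarrow>
        filterlim d at_top sequentially \<longrightarrow>
        (let A = (\<lambda>n. scaled_adjacency n (\<beta> / real (d n)) (G n))
         in (\<lambda>n. op_norm (A n)) \<in> O(\<lambda>_. 1) \<and>
            (\<lambda>n. trace_mat (A n ^\<^sub>m 2)) \<in> o(\<lambda>n. real n))) \<and>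
     (\<forall>\<beta>>0::real. \<forall>p :: nat \<Rightarrow> real.
        (\<forall>n\<ge>1. p n \<in> {0..1}) \<longrightarrow>
        (\<lambda>n. real n * p n) \<ggreater> (\<lambda>n. sqrt (ln (real n) / ln (ln (real n)))) \<longrightarrow>
        (let M = (\<lambda>n. measure_pmf (erdos_renyi n (p n)));
             A = (\<lambda>n E. scaled_adjacency n (\<beta> / (real n * p n)) E)
         in bounded_whp M (\<lambda>n E. op_norm (A n E)) \<and>
            smallo_whp M (\<lambda>n E. trace_mat (A n E ^\<^sub>m 2)) (\<lambda>n. real n))) \<and>
     (\<forall>\<beta>>0::real. \<forall>(W :: real \<Rightarrow> real \<Rightarrow> real) (\<rho> :: nat \<Rightarrow> real).
        graphon W \<longrightarrow>
        (\<forall>n\<ge>1. \<forall>x\<in>{0..1}. \<forall>y\<in>{0..1}. \<rho> n * W x y \<in> {0..1}) \<longrightarrow>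
        (\<lambda>n. real n * \<rho> n) \<ggreater> (\<lambda>n. sqrt (ln (real n) / ln (ln (real n)))) \<longrightarrow>
        (let M = (\<lambda>n. graphon_graph n (\<rho> n) W);
             A = (\<lambda>n E. scaled_adjacency n (\<beta> / (real n * \<rho> n)) E)
         in bounded_whp M (\<lambda>n E. op_norm (A n E)) \<and>
            smallo_whp M (\<lambda>n E. trace_mat (A n E ^\<^sub>m 2)) (\<lambda>n. real n)))"
proof (unfold Let_def, intro conjI allI impI, goal_cases)
  case 1 then show ?case by (rule complete_graph(1))
next
  case 2 then show ?case by (rule complete_graph(2))
next
  case 3 then show ?case by (rule regular_graphs(1))
next
  case 4 then show ?case by (rule regular_graphs(2))
next
  case 5 then show ?case by (rule erdos_renyi_graphs(1))
next
  case 6 then show ?case by (rule erdos_renyi_graphs(2))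
next
  case 7 then show ?case by (rule graphon_graphs(1))
next
  case 8 then show ?case by (rule graphon_graphs(2))
qed

end
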